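(* Let $h(x)=\mathbb E_\xi\left[\max_{i\in\mathbb I_q}\{h_i(x,\xi)\}\right]$, $\mathbb I_q=\{1,\dots,q\}$. Assume that for each $i\in\mathbb I_q$ and a.e. $\xi\in\Xi$, $\tilde h_{i,\mu}(\cdot,\xi)$ is a smoothing function of $h_i(\cdot,\xi)$ with parameters $(\kappa_{i,\xi},K_{i,\xi},\mathcal L_{h_{i,\xi}})$. Let $$\tilde h_\mu(x)=\mathbb E_\xi\left[\mu\ln\left(\sum_{i=1}^qe^{\tilde h_{i,\mu}(x,\xi)/\mu}\right)\right].$$ Assume also that for each $i\in\mathbb I_q$ and a.e. $\xi\in\Xi$ there exists a constant $M_{i,\xi}\ge0$, independent of $x\in X$ and $\mu\in(0,\bar\mu]$, such that $$\max_{x\in X,\ \mu\in(0,\bar\mu]}\left\{\|\nabla\tilde h_{i,\mu}(x,\xi)\|\right\}\le M_{i,\xi}<\infty.$$ Then: (i) $\tilde h_\mu$ is a smoothing function of $h$ with parameters $(\kappa,K,\mathcal L_h)$, where $$\kappa=\ln q+\mathbb E_\xi\left[\sqrt{\sum_{i=1}^q\kappa_{i,\xi}^2}\right],\quad K=\sum_{i=1}^q\mathbb E_\xi[K_{i,\xi}],\quad \mathcal L_h=\mathbb E_\xi\left[\left(\sum_{i=1}^qM_{i,\xi}\right)^2+\sum_{i=1}^q\mathcal L_{h_{i,\xi}}\right].$$ (ii) The unbiasedness and bounded-variance condition holds for the stochastic gradient $\nabla\tilde{\mathbf\Psi}_\mu(x,\zeta)$ with $\zeta=(\xi^T,i)^T$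 and $\sigma^2=\mathbb E_{\xi,i}\left[(M_{i,\xi})^2\right]$.
   Context: **Setting.** $X\subseteq\mathbb R^d$ is closed and convex; $\xi$ is a random vector with support $\Xi$; each $h_i(\cdot,\xi)$ is convex (possibly nonsmooth) on $X$; $h$ is finite-valued and continuous on $X$; $f:X\to\mathbb R$ is convex with Lipschitz gradient; $\bar\mu>0$; $\|\cdot\|$ is the Euclidean norm; gradients are with respect to $x$. **Smoothing function.** For convex $c:X\to\mathbb R$, a function $\tilde c:X\times(0,\bar\mu]\to\mathbb R$ (write $\tilde c_\mu=\tilde c(\cdot,\mu)$) is a smoothing function of $c$ with parameters $(\kappa,K,\mathcal L_c)$ if for every $\mu\in(0,\bar\mu]$, $\tilde c_\mu$ is continuously differentiable on $X$ and: (a) $\lim_{z\to x,\mu\downarrow0}\tilde c(z,\mu)=c(x)$ for all $x\in X$; (b) $\tilde c_\mu$ is convex on $X$; (c) $|\tilde c(x,\mu_2)-\tilde c(x,\mu_1)|\le\kappa|\mu_1-\mu_2|$ for all $x\in X$, $\mu_1,\mu_2\in(0,\bar\mu]$, with constant $\kappa>0$; (d) $\nabla\tilde c_\mu$ is Lipschitz on $X$ with constant $K+\mathcal L_c/\mu$, where $K$ and $\mathcal L_c>0$ do not depend on $\mu$. **Stochastic gradient.** For given $x\in X$, $\mu\in(0,\bar\mu]$, the random vector $(\xi^T,i)^T\in\Xi\times\mathbb I_q$ has the distribution in which $\xi$ has its given distribution and, conditionally on $\xi$, $i$ has probabilities $p^\xi_{x,\mu}(i)=e^{\tilde h_{i,\mu}(x,\xi)/\mu}\big/\sum_{j=1}^qe^{\tilde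 h_{j,\mu}(x,\xi)/\mu}$; $\mathbb E_{\xi,i}$ is the expectation with respect to it. $\tilde\psi_\mu=f+\tilde h_\mu$ and $\nabla\tilde{\mathbf\Psi}_\mu(x,\xi,i)=\nabla f(x)+\nabla\tilde h_{i,\mu}(x,\xi)$. **Unbiasedness and bounded-variance condition** (with $\sigma^2$): for every $x\in X$ and $\mu\in(0,\bar\mu]$, $\mathbb E_\zeta[\nabla\tilde{\mathbf\Psi}_\mu(x,\zeta)]=\nabla\tilde\psi_\mu(x)$ and $\mathbb E_\zeta[\|\nabla\tilde{\mathbf\Psi}_\mu(x,\zeta)-\nabla\tilde\psi_\mu(x)\|^2]\le\sigma^2$. *)

theory Defs
  imports "HOL-Probability.Probability"
begin

text \<open>
  A function on a convex set \<open>X\<close> determines its derivative only in the directions of the affine hull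
  of \<open>X\<close>.  The gradient relative to \<open>X\<close> is therefore normalised to lie in the direction space of
  \<open>X\<close>, which makes it unique even if \<open>X\<close> has empty interior. At interior points it is the usual
  gradient (lemma \<open>grad_interior\<close>), at boundary points it is the derivative taken within \<open>X\<close>.
\<close>

definition is_grad :: "'a::euclidean_space set \<Rightarrow> ('a \<Rightarrow> real) \<Rightarrow> 'a \<Rightarrow> 'a \<Rightarrow> bool" where
  "is_grad X c x g \<longleftrightarrow>
     g \<in> span ((\<lambda>y. y - x) ` X) \<and> (c has_derivative (\<lambda>v. g \<bullet> v)) (at x within X)"

definition grad :: "'a::euclidean_space set \<Rightarrow> ('a \<Rightarrow> real) \<Rightarrow> 'a \<Rightarrow> 'a" where
  "grad X c x = (THE g. is_grad X c x g)"

lemma is_grad_unique: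
  fixes X :: "'a::euclidean_space set"
  assumes "convex X" "x \<in> X" "is_grad X c x g1" "is_grad X c x g2"
  shows "g1 = g2"
proof -
  have "(g1 - g2) \<bullet> (y - x) = 0" if y: "y \<in> X" for y
  proof -
    let ?l = "\<lambda>t::real. x + t *\<^sub>R (y - x)"
    have img: "?l ` {0..1} \<subseteq> X"
    proof clarify
      fix t :: real assume "t \<in> {0..1}"
      then have "(1 - t) *\<^sub>R x + t *\<^sub>R y \<in> X"
        using assms(1,2) y by (auto intro: convexD)
      then show "?l t \<in> X" by (simp add: algebra_simps)
    qed
    have l: "(?l has_derivative (\<lambda>t. t *\<^sub>R (y - x))) (at 0 within {0..1})"
      by (auto intro!: derivative_eq_intros)
    have d: "((c \<circ> ?l) has_vector_derivative g \<bullet> (y - x)) (at 0 within {0..1})"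
      if "is_grad X c x g" for g
    proof -
      have "(c has_derivative (\<lambda>v. g \<bullet> v)) (at (?l 0) within ?l ` {0..1})"
        using that img unfolding is_grad_def by (auto intro: has_derivative_subset)
      from diff_chain_within[OF l this] show ?thesis
        by (simp add: has_vector_derivative_def o_def)
    qed
    have "g1 \<bullet> (y - x) = g2 \<bullet> (y - x)"
      using d[OF assms(3)] d[OF assms(4)]
      by (intro vector_derivative_unique_within_closed_interval[of 0 1 0 "c \<circ> ?l"]) auto
    then show ?thesis by (simp add: inner_diff_left)
  qed
  then have "orthogonal (g1 - g2) z" if "z \<in> span ((\<lambda>y. y - x) ` X)" for z
    using that by (intro orthogonal_to_span[of z]) (auto simp: orthogonal_def)
  moreover have "g1 - g2 \<in> span ((\<lambda>y. y - x) ` X)"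
    using assms(3,4) by (auto simp: is_grad_def span_diff)
  ultimately have "(g1 - g2) \<bullet> (g1 - g2) = 0"
    unfolding orthogonal_def by blast
  then show ?thesis by simp
qed

lemma grad_eq:
  assumes "convex X" "x \<in> X" "is_grad X c x g"
  shows "grad X c x = g"
  unfolding grad_def using assms by (blast intro: is_grad_unique)

lemma is_grad_grad:
  fixes X :: "'a::euclidean_space set"
  assumes "convex X" "x \<in> X" "c differentiable (at x within X)"
  shows "is_grad X c x (grad X c x)"
proof -
  let ?V = "span ((\<lambda>y. y - x) ` X)"
  obtain D where D: "(c has_derivative D) (at x within X)"
    using assms(3) by (auto simp: differentiable_def)
  define g0 where "g0 = (\<Sum>b\<in>Basis. D b *\<^sub>R b)"
  have lin: "linear D" using D by (auto dest: has_derivative_linear)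
  have D0: "D v = g0 \<bullet> v" for v
  proof -
    have "D v = D (\<Sum>b\<in>Basis. (v \<bullet> b) *\<^sub>R b)" by (simp add: euclidean_representation)
    also have "\<dots> = (\<Sum>b\<in>Basis. (v \<bullet> b) * D b)"
      using lin by (simp add: linear_sum linear_cmul)
    also have "\<dots> = g0 \<bullet> v"
      by (simp add: g0_def inner_sum_left inner_commute[of v] mult.commute)
    finally show ?thesis .
  qed
  obtain g z where gz: "g \<in> ?V" "\<And>w. w \<in> ?V \<Longrightarrow> orthogonal z w" "g0 = g + z"
    using orthogonal_subspace_decomp_exists[of "(\<lambda>y. y - x) ` X" g0] by blast
  have eq: "D (y - x) = g \<bullet> (y - x)" if "y \<in> X" for y
    using that gz(2)[of "y - x"] gz(3)
    by (auto simp: D0 inner_add_left orthogonal_def span_base)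
  have "((\<lambda>y. (1 / norm (y - x)) *\<^sub>R (c y - (c x + D (y - x)))) \<longlongrightarrow> 0) (at x within X)"
    using D by (simp add: has_derivative_within)
  also have "?this \<longleftrightarrow>
      ((\<lambda>y. (1 / norm (y - x)) *\<^sub>R (c y - (c x + g \<bullet> (y - x)))) \<longlongrightarrow> 0) (at x within X)"
    by (rule Lim_cong_within) (simp_all only: eq)
  finally have "(c has_derivative (\<lambda>v. g \<bullet> v)) (at x within X)"
    by (simp add: has_derivative_within bounded_linear_inner_right)
  with gz(1) have "is_grad X c x g" by (simp add: is_grad_def)
  then show ?thesis using grad_eq[OF assms(1,2)] by simp
qed

lemma grad_interior:
  fixes X :: "'a::euclidean_space set"
  assumes "convex X" "x \<in> interior X" "(c has_derivative (\<lambda>v. g \<bullet> v)) (at x)"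
  shows "grad X c x = g"
proof -
  have "g \<in> span ((\<lambda>y. y - x) ` X)"
  proof (cases "g = 0")
    case False
    obtain e where e: "e > 0" "cball x e \<subseteq> X"
      using assms(2) unfolding mem_interior_cball by blast
    let ?t = "e / norm g"
    have "x + ?t *\<^sub>R g \<in> cball x e" using e(1) False by (simp add: dist_norm)
    then have "x + ?t *\<^sub>R g \<in> X" using e(2) by blast
    then have "?t *\<^sub>R g \<in> (\<lambda>y. y - x) ` X"
      by (intro image_eqI[of _ _ "x + ?t *\<^sub>R g"]) simp_all
    then have "(1 / ?t) *\<^sub>R (?t *\<^sub>R g) \<in> span ((\<lambda>y. y - x) ` X)"
      by (intro span_mul span_base)
    then show ?thesis using e False by simp
  qed (simp add: span_zero)
  moreover have "(c has_derivative (\<lambda>v. g \<bullet> v)) (at x within X)"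
    using assms(3) by (rule has_derivative_at_withinI)
  ultimately have "is_grad X c x g"
    unfolding is_grad_def by (rule conjI)
  moreover have "x \<in> X" using assms(2) interior_subset by (rule rev_subsetD)
  ultimately show ?thesis
    using assms(1) by (intro grad_eq)
qed

text \<open>
  The point \<open>(x, 0)\<close> is not in \<open>X \<times> {0<..mubar}\<close>, so the limit below also ranges over the pairs
  \<open>(x, \<mu>)\<close>.
\<close>

definition smoothing_function ::
  "'a::euclidean_space set \<Rightarrow> real \<Rightarrow> ('a \<Rightarrow> real) \<Rightarrow> ('a \<Rightarrow> real \<Rightarrow> real) \<Rightarrow> real \<Rightarrow> real \<Rightarrow> real \<Rightarrow> bool"
where
  "smoothing_function X mubar c ct \<kappa> K L \<longleftrightarrow>
     \<kappa> > 0 \<and> L > 0 \<and>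
     (\<forall>\<mu>\<in>{0<..mubar}. (\<lambda>x. ct x \<mu>) differentiable_on X \<and> continuous_on X (grad X (\<lambda>x. ct x \<mu>))) \<and>
     (\<forall>x\<in>X. ((\<lambda>(z, \<mu>). ct z \<mu>) \<longlongrightarrow> c x) (at (x, 0) within X \<times> {0<..mubar})) \<and>
     (\<forall>\<mu>\<in>{0<..mubar}. convex_on X (\<lambda>x. ct x \<mu>)) \<and>
     (\<forall>x\<in>X. \<forall>\<mu>1\<in>{0<..mubar}. \<forall>\<mu>2\<in>{0<..mubar}. \<bar>ct x \<mu>2 - ct x \<mu>1\<bar> \<le> \<kappa> * \<bar>\<mu>1 - \<mu>2\<bar>) \<and>
     (\<forall>\<mu>\<in>{0<..mubar}. (K + L / \<mu>)-lipschitz_on X (grad X (\<lambda>x. ct x \<mu>)))"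

definition law_support :: "'m::topological_space measure \<Rightarrow> 'm set" where
  "law_support P = {s. \<forall>U. open U \<longrightarrow> s \<in> U \<longrightarrow> emeasure P U \<noteq> 0}"

definition expected_max :: "'m measure \<Rightarrow> nat \<Rightarrow> (nat \<Rightarrow> 'a \<Rightarrow> 'm \<Rightarrow> real) \<Rightarrow> 'a \<Rightarrow> real" where
  "expected_max P q h x = (\<integral>\<xi>. Max ((\<lambda>i. h i x \<xi>) ` {1..q}) \<partial>P)"

definition log_sum_exp :: "nat \<Rightarrow> (nat \<Rightarrow> 'a \<Rightarrow> real \<Rightarrow> 'm \<Rightarrow> real) \<Rightarrow> 'a \<Rightarrow> real \<Rightarrow> 'm \<Rightarrow> real" where
  "log_sum_exp q ht x \<mu> \<xi> = \<mu> * ln (\<Sum>i=1..q. exp (ht i x \<mu> \<xi> / \<mu>))"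

definition expected_lse ::
  "'m measure \<Rightarrow> nat \<Rightarrow> (nat \<Rightarrow> 'a \<Rightarrow> real \<Rightarrow> 'm \<Rightarrow> real) \<Rightarrow> 'a \<Rightarrow> real \<Rightarrow> real" where
  "expected_lse P q ht x \<mu> = (\<integral>\<xi>. log_sum_exp q ht x \<mu> \<xi> \<partial>P)"

definition index_prob ::
  "nat \<Rightarrow> (nat \<Rightarrow> 'a \<Rightarrow> real \<Rightarrow> 'm \<Rightarrow> real) \<Rightarrow> 'a \<Rightarrow> real \<Rightarrow> 'm \<Rightarrow> nat \<Rightarrow> real" where
  "index_prob q ht x \<mu> \<xi> i = exp (ht i x \<mu> \<xi> / \<mu>) / (\<Sum>j=1..q. exp (ht j x \<mu> \<xi> / \<mu>))"

text \<open>
  The law of \<open>(\<xi>, i)\<close> with marginal \<open>P\<close> of \<open>\<xi>\<close> and conditional probabilities \<open>index_prob\<close> of \<open>i\<close>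
  given \<open>\<xi>\<close>; it depends on \<open>x\<close> and \<open>\<mu>\<close>.
\<close>

definition sample_law ::
  "'m measure \<Rightarrow> nat \<Rightarrow> (nat \<Rightarrow> 'a \<Rightarrow> real \<Rightarrow> 'm \<Rightarrow> real) \<Rightarrow> 'a \<Rightarrow> real \<Rightarrow> ('m \<times> nat) measure" where
  "sample_law P q ht x \<mu> =
     density (P \<Otimes>\<^sub>M count_space {1..q}) (\<lambda>(\<xi>, i). ennreal (index_prob q ht x \<mu> \<xi> i))"

definition stoch_grad ::
  "'a::euclidean_space set \<Rightarrow> ('a \<Rightarrow> real) \<Rightarrow> (nat \<Rightarrow> 'a \<Rightarrow> real \<Rightarrow> 'm \<Rightarrow> real) \<Rightarrow>
   'a \<Rightarrow> real \<Rightarrow> 'm \<times> nat \<Rightarrow> 'a" where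
  "stoch_grad X f ht x \<mu> = (\<lambda>(\<xi>, i). grad X f x + grad X (\<lambda>y. ht i y \<mu> \<xi>) x)"

text \<open>
  The condition for an objective \<open>\<psi>\<close>, a stochastic gradient \<open>G\<close> and the law \<open>Q x \<mu>\<close> of the sample.
  The variance bound \<open>\<sigma>2\<close> may depend on \<open>(x, \<mu>)\<close>, since an expectation under \<open>Q x \<mu>\<close> does, but it
  must be bounded.  Integrability is required explicitly because the Bochner integral of a
  non-integrable function is \<open>0\<close>.
\<close>

definition unbiased_bounded_variance ::
  "'a::euclidean_space set \<Rightarrow> real \<Rightarrow> ('a \<Rightarrow> real \<Rightarrow> real) \<Rightarrow> ('a \<Rightarrow> real \<Rightarrow> 'z \<Rightarrow> 'a) \<Rightarrow>
   ('a \<Rightarrow> real \<Rightarrow> 'z measure) \<Rightarrow> ('a \<Rightarrow> real \<Rightarrow> real) \<Rightarrow> bool" where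
  "unbiased_bounded_variance X mubar \<psi> G Q \<sigma>2 \<longleftrightarrow>
     (\<exists>C. \<forall>x\<in>X. \<forall>\<mu>\<in>{0<..mubar}. \<sigma>2 x \<mu> \<le> C) \<and>
     (\<forall>x\<in>X. \<forall>\<mu>\<in>{0<..mubar}.
        integrable (Q x \<mu>) (G x \<mu>) \<and>
        (\<integral>\<zeta>. G x \<mu> \<zeta> \<partial>Q x \<mu>) = grad X (\<lambda>y. \<psi> y \<mu>) x \<and>
        integrable (Q x \<mu>) (\<lambda>\<zeta>. (norm (G x \<mu> \<zeta> - grad X (\<lambda>y. \<psi> y \<mu>) x))\<^sup>2) \<and>
        (\<integral>\<zeta>. (norm (G x \<mu> \<zeta> - grad X (\<lambda>y. \<psi> y \<mu>) x))\<^sup>2 \<partial>Q x \<mu>) \<le> \<sigma>2 x \<mu>)"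

end

theory Submission
  imports Defs
begin

text \<open>
  Almost surely, \<open>\<mu> * ln (\<Sum>i. exp (ht i x \<mu> \<xi> / \<mu>))\<close> is a smoothing function of the maximum of the
  \<open>h i x \<xi>\<close>. The properties in the definition of a smoothing function, apart from the limit as
  \<open>\<mu>\<close> tends to \<open>0\<close>, can be phrased as inequalities, and these survive taking expectations. The limit
  then follows from the Lipschitz condition in \<open>\<mu>\<close> and the continuity of the expected maximum.

  The pointwise part rests on Gibbs' inequality (\<open>lse_tangent\<close>): the softmax weights form a
  subgradient of log-sum-exp. Its joint version in the argument and the parameter
  (\<open>scaled_lse_tangent\<close>) has the entropy of the weights, a number between \<open>0\<close> and \<open>ln q\<close>, as its
  slope in \<open>\<mu>\<close>. This explains the term \<open>ln q\<close> in \<open>\<kappa>\<close>; the variation of each \<open>ht i\<close> in \<open>\<mu>\<close> adds at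
  most the largest \<open>\<kappa> i\<close>, which is at most the square root of the sum of their squares. Since the
  weights are nonnegative, Gibbs' inequality composed with the gradient inequalities of the convex
  functions \<open>ht i\<close> shows that the softmax mean of their gradients is a subgradient of the smoothed
  maximum. It is Lipschitz: a change of the weights is governed by a covariance
  (\<open>softmax_mean_lipschitz\<close>), which produces the term \<open>(\<Sum>i. M i)\<^sup>2 / \<mu>\<close>, and a change of the
  gradients produces the terms \<open>K i + L i / \<mu>\<close>.

  A selection of subgradients that is Lipschitz forces the function to be convex and differentiable
  with that selection as its gradient (\<open>convex_on_if_subgradients\<close>,
  \<open>is_grad_if_lipschitz_subgradients\<close>). Both the subgradient inequality and the Lipschitz bound can
  be integrated over \<open>\<xi>\<close>, so the expectation is again smooth, its gradient is the expected gradient,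
  and no theorem on differentiation under the integral is involved
  (\<open>smoothing_function_expectation\<close>).

  For the stochastic gradient, the index \<open>i\<close> is drawn with exactly the softmax weights, so its
  conditional mean given \<open>\<xi>\<close> is the gradient of the smoothed maximum, up to the deterministic
  gradient of \<open>f\<close>. The variance is at most the second moment of the gradient of the drawn \<open>ht i\<close>,
  hence at most that of \<open>M i\<close> (\<open>mixture_mean_variance\<close>).
\<close>

section \<open>Log-sum-exp and softmax\<close>

definition lse :: "'i set \<Rightarrow> ('i \<Rightarrow> real) \<Rightarrow> real" where
  "lse I v = ln (\<Sum>i\<in>I. exp (v i))"

definition softmax :: "'i set \<Rightarrow> ('i \<Rightarrow> real) \<Rightarrow> 'i \<Rightarrow> real" where
  "softmax I v i = exp (v i) / (\<Sum>j\<in>I. exp (v j))"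

lemma sum_exp_pos:
  assumes "finite I" "I \<noteq> {}"
  shows "(\<Sum>i\<in>I. exp (v i :: real)) > 0"
  using assms by (intro sum_pos) auto

lemma softmax_nonneg: "softmax I v i \<ge> 0"
  unfolding softmax_def by (intro divide_nonneg_nonneg sum_nonneg) auto

lemma sum_softmax:
  assumes "finite I" "I \<noteq> {}"
  shows "(\<Sum>i\<in>I. softmax I v i) = 1"
  using sum_exp_pos[OF assms, of v] by (simp add: softmax_def sum_divide_distrib[symmetric])

lemma weighted_mean_le:
  fixes p z :: "'i \<Rightarrow> real"
  assumes "\<And>i. i \<in> I \<Longrightarrow> p i \<ge> 0" "sum p I = 1" "\<And>i. i \<in> I \<Longrightarrow> z i \<le> B"
  shows "(\<Sum>i\<in>I. p i * z i) \<le> B"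
proof -
  have "(\<Sum>i\<in>I. p i * z i) \<le> (\<Sum>i\<in>I. p i * B)"
    using assms by (intro sum_mono mult_left_mono) auto
  also have "\<dots> = B" using assms(2) by (simp add: sum_distrib_right[symmetric])
  finally show ?thesis .
qed

lemma le_lse:
  assumes "finite I" "i \<in> I"
  shows "v i \<le> lse I v"
proof -
  have "exp (v i) \<le> (\<Sum>j\<in>I. exp (v j))"
    using assms by (intro member_le_sum) auto
  then have "ln (exp (v i)) \<le> lse I v"
    unfolding lse_def by (intro ln_mono) auto
  then show ?thesis by simp
qed

text \<open>
  Gibbs' inequality, the source of the convexity of log-sum-exp and of its Lipschitz bounds: the
  softmax weights are a subgradient. It follows by averaging \<open>exp z \<ge> exp m * (1 + (z - m))\<close>, for
  \<open>z = v i - u i\<close> and its weighted mean \<open>m\<close>, over the weights: the linear terms cancel.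
\<close>

lemma lse_tangent:
  assumes I: "finite I" "I \<noteq> {}"
  shows "lse I u + (\<Sum>i\<in>I. softmax I u i * (v i - u i)) \<le> lse I v"
proof -
  define S where "S = (\<Sum>i\<in>I. exp (u i))"
  define m where "m = (\<Sum>i\<in>I. softmax I u i * (v i - u i))"
  have S: "S > 0" using sum_exp_pos[OF I] by (simp add: S_def)
  have "exp m = (\<Sum>i\<in>I. softmax I u i * (exp m * (1 + (v i - u i - m))))"
  proof -
    have "(\<Sum>i\<in>I. softmax I u i * (exp m * (1 + (v i - u i - m))))
        = (\<Sum>i\<in>I. exp m * (1 - m) * softmax I u i + exp m * (softmax I u i * (v i - u i)))"
      by (intro sum.cong) (auto simp: algebra_simps)
    also have "\<dots> = exp m * (1 - m) * (\<Sum>i\<in>I. softmax I u i) + exp m * m"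
      by (simp add: sum.distrib sum_distrib_left[symmetric] m_def)
    finally show ?thesis by (simp add: sum_softmax[OF I] algebra_simps)
  qed
  also have "\<dots> \<le> (\<Sum>i\<in>I. softmax I u i * exp (v i - u i))"
  proof (intro sum_mono mult_left_mono softmax_nonneg)
    fix i
    have "exp m * (1 + (v i - u i - m)) \<le> exp m * exp (v i - u i - m)"
      by (intro mult_left_mono exp_ge_add_one_self) simp
    then show "exp m * (1 + (v i - u i - m)) \<le> exp (v i - u i)"
      by (simp add: exp_add[symmetric])
  qed
  also have "\<dots> = (\<Sum>i\<in>I. exp (v i)) / S"
    by (simp add: softmax_def S_def exp_diff sum_divide_distrib)
  finally have "S * exp m \<le> (\<Sum>i\<in>I. exp (v i))"
    using S by (simp add: field_simps)
  then have "ln (S * exp m) \<le> lse I v"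
    unfolding lse_def using S by (intro ln_mono) auto
  then show ?thesis
    using S by (simp add: ln_mult m_def S_def lse_def)
qed

text \<open>
  The quantity bounded here is the Shannon entropy of the softmax weights. It is nonnegative because
  log-sum-exp dominates every component, hence every mean of them; it is at most the logarithm of the
  number of components by comparison with the tangent at \<open>u\<close>, evaluated at the zero vector.
\<close>

lemma softmax_entropy_bounds:
  assumes I: "finite I" "I \<noteq> {}"
  shows "0 \<le> lse I u - (\<Sum>i\<in>I. softmax I u i * u i)"
    and "lse I u - (\<Sum>i\<in>I. softmax I u i * u i) \<le> ln (real (card I))"
proof -
  show "0 \<le> lse I u - (\<Sum>i\<in>I. softmax I u i * u i)"
    using weighted_mean_le[of I "softmax I u" u "lse I u"] sum_softmax[OF I] le_lse[OF I(1)]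
    by (simp add: softmax_nonneg)
  show "lse I u - (\<Sum>i\<in>I. softmax I u i * u i) \<le> ln (real (card I))"
    using lse_tangent[OF I, of u "\<lambda>_. 0"] by (simp add: sum_negf lse_def)
qed

text \<open>
  The function \<open>(a, \<mu>) \<mapsto> \<mu> * lse (a / \<mu>)\<close> is the perspective of log-sum-exp, hence jointly
  convex, and its partial derivative in \<open>\<mu>\<close> is the entropy of the weights. The joint tangent handles
  a perturbation of \<open>a\<close> and of \<open>\<mu>\<close> at once, so that \<open>a\<close> need not depend differentiably on \<open>\<mu>\<close>.
\<close>

lemma scaled_lse_tangent:
  fixes a b :: "'i \<Rightarrow> real"
  assumes I: "finite I" "I \<noteq> {}" and pos: "\<mu>1 > 0" "\<mu>2 > (0::real)"
  defines "p \<equiv> softmax I (\<lambda>i. a i / \<mu>1)"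
  shows "\<mu>1 * lse I (\<lambda>i. a i / \<mu>1) + (\<Sum>i\<in>I. p i * (b i - a i))
         + (\<mu>2 - \<mu>1) * (lse I (\<lambda>i. a i / \<mu>1) - (\<Sum>i\<in>I. p i * (a i / \<mu>1)))
       \<le> \<mu>2 * lse I (\<lambda>i. b i / \<mu>2)"
proof -
  have "\<mu>2 * (lse I (\<lambda>i. a i / \<mu>1) + (\<Sum>i\<in>I. p i * (b i / \<mu>2 - a i / \<mu>1)))
      \<le> \<mu>2 * lse I (\<lambda>i. b i / \<mu>2)"
    unfolding p_def using pos by (intro mult_left_mono lse_tangent[OF I]) auto
  moreover have "\<mu>2 * (\<Sum>i\<in>I. p i * (b i / \<mu>2 - a i / \<mu>1))
      = (\<Sum>i\<in>I. p i * (b i - a i)) - (\<mu>2 - \<mu>1) * (\<Sum>i\<in>I. p i * (a i / \<mu>1))"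
    unfolding sum_distrib_left sum_subtractf[symmetric]
    using pos by (intro sum.cong) (auto simp: field_simps)
  ultimately show ?thesis by (simp add: algebra_simps)
qed

text \<open>
  By the joint tangent, a decrease is at most the weighted mean of the changes of \<open>a\<close> plus the
  entropy times the change of \<open>\<mu>\<close>; exchanging the two points turns this into a two-sided bound.
\<close>

lemma scaled_lse_lipschitz:
  fixes a b :: "'i \<Rightarrow> real"
  assumes I: "finite I" "I \<noteq> {}" and pos: "\<mu>1 > 0" "\<mu>2 > (0::real)"
    and ab: "\<And>i. i \<in> I \<Longrightarrow> \<bar>b i - a i\<bar> \<le> D"
  shows "\<bar>\<mu>2 * lse I (\<lambda>i. b i / \<mu>2) - \<mu>1 * lse I (\<lambda>i. a i / \<mu>1)\<bar>
       \<le> ln (real (card I)) * \<bar>\<mu>1 - \<mu>2\<bar> + D"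
proof -
  have half: "\<mu>1 * lse I (\<lambda>i. a i / \<mu>1) - \<mu>2 * lse I (\<lambda>i. b i / \<mu>2)
      \<le> ln (real (card I)) * \<bar>\<mu>1 - \<mu>2\<bar> + D"
    if pos: "\<mu>1 > 0" "\<mu>2 > (0::real)" and ab: "\<And>i. i \<in> I \<Longrightarrow> \<bar>b i - a i\<bar> \<le> D"
    for a b :: "'i \<Rightarrow> real" and \<mu>1 \<mu>2
  proof -
    define p where "p = softmax I (\<lambda>i. a i / \<mu>1)"
    define H where "H = lse I (\<lambda>i. a i / \<mu>1) - (\<Sum>i\<in>I. p i * (a i / \<mu>1))"
    have H: "0 \<le> H" "H \<le> ln (real (card I))"
      unfolding H_def p_def by (rule softmax_entropy_bounds[OF I])+
    have "(\<Sum>i\<in>I. p i * (a i - b i)) \<le> D"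
      using ab sum_softmax[OF I]
      by (intro weighted_mean_le) (fastforce simp: p_def softmax_nonneg abs_le_iff)+
    moreover have "(\<Sum>i\<in>I. p i * (a i - b i)) = - (\<Sum>i\<in>I. p i * (b i - a i))"
      by (simp add: sum_negf[symmetric] algebra_simps)
    moreover have "(\<mu>1 - \<mu>2) * H \<le> ln (real (card I)) * \<bar>\<mu>1 - \<mu>2\<bar>"
    proof -
      have "(\<mu>1 - \<mu>2) * H \<le> \<bar>\<mu>1 - \<mu>2\<bar> * H" using H by (intro mult_right_mono) auto
      also have "\<dots> \<le> \<bar>\<mu>1 - \<mu>2\<bar> * ln (real (card I))" using H by (intro mult_left_mono) auto
      finally show ?thesis by (simp add: mult.commute)
    qed
    moreover have "(\<mu>2 - \<mu>1) * H = - ((\<mu>1 - \<mu>2) * H)" by (simp add: algebra_simps)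
    ultimately show ?thesis
      using scaled_lse_tangent[OF I pos, of a b] unfolding p_def[symmetric] H_def[symmetric] by linarith
  qed
  show ?thesis
    using half[OF pos, of b a] half[OF pos(2,1), of a b] ab
    by (simp add: abs_le_iff abs_minus_commute)
qed

lemma scaled_lse_Max_bounds:
  fixes a :: "'i \<Rightarrow> real"
  assumes I: "finite I" "I \<noteq> {}" and \<mu>: "\<mu> > 0"
  shows "Max (a ` I) \<le> \<mu> * lse I (\<lambda>i. a i / \<mu>)"
    and "\<mu> * lse I (\<lambda>i. a i / \<mu>) \<le> Max (a ` I) + \<mu> * ln (real (card I))"
proof -
  have "a i \<le> \<mu> * lse I (\<lambda>i. a i / \<mu>)" if "i \<in> I" for i
    using le_lse[OF I(1) that, of "\<lambda>i. a i / \<mu>"] \<mu> by (simp add: field_simps)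
  then show "Max (a ` I) \<le> \<mu> * lse I (\<lambda>i. a i / \<mu>)"
    using I by simp
  have "(\<Sum>i\<in>I. softmax I (\<lambda>i. a i / \<mu>) i * (a i / \<mu>)) \<le> Max (a ` I) / \<mu>"
    using I \<mu> sum_softmax[OF I]
    by (intro weighted_mean_le divide_right_mono) (auto simp: softmax_nonneg)
  then have "lse I (\<lambda>i. a i / \<mu>) \<le> Max (a ` I) / \<mu> + ln (real (card I))"
    using softmax_entropy_bounds(2)[OF I, of "\<lambda>i. a i / \<mu>"] by linarith
  then have "\<mu> * lse I (\<lambda>i. a i / \<mu>) \<le> \<mu> * (Max (a ` I) / \<mu> + ln (real (card I)))"
    using \<mu> by (intro mult_left_mono) auto
  then show "\<mu> * lse I (\<lambda>i. a i / \<mu>) \<le> Max (a ` I) + \<mu> * ln (real (card I))"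
    using \<mu> by (simp add: distrib_left)
qed

text \<open>
  Cauchy-Schwarz for the weighted inner product, applied to \<open>d\<close> centred at its mean. Centring does
  not increase the second moment, which is why the constant is \<open>A * B\<close> and not \<open>2 * A * B\<close>.
\<close>

lemma covariance_bound:
  fixes p d y :: "'i \<Rightarrow> real"
  assumes p: "\<And>i. i \<in> I \<Longrightarrow> p i \<ge> 0" "sum p I = 1"
    and d: "\<And>i. i \<in> I \<Longrightarrow> \<bar>d i\<bar> \<le> A" and y: "\<And>i. i \<in> I \<Longrightarrow> \<bar>y i\<bar> \<le> B"
    and AB: "0 \<le> A" "0 \<le> B"
  shows "\<bar>(\<Sum>i\<in>I. p i * d i * y i) - (\<Sum>i\<in>I. p i * d i) * (\<Sum>i\<in>I. p i * y i)\<bar> \<le> A * B"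
proof -
  define m where "m = (\<Sum>i\<in>I. p i * d i)"
  have sq: "(\<Sum>i\<in>I. p i * (z i)\<^sup>2) \<le> C\<^sup>2" if "\<And>i. i \<in> I \<Longrightarrow> \<bar>z i\<bar> \<le> C" "0 \<le> C" for z C
    using that by (intro weighted_mean_le[OF p]) (auto intro: power2_le_iff_abs_le[THEN iffD2])
  have "(\<Sum>i\<in>I. p i * (d i - m)\<^sup>2) = (\<Sum>i\<in>I. p i * (d i)\<^sup>2) - m\<^sup>2"
  proof -
    have "(\<Sum>i\<in>I. p i * (d i - m)\<^sup>2) = (\<Sum>i\<in>I. p i * (d i)\<^sup>2) - 2 * m * (\<Sum>i\<in>I. p i * d i) + m\<^sup>2 * sum p I"
      by (simp add: power2_eq_square algebra_simps sum.distrib sum_subtractf sum_distrib_left)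
    then show ?thesis by (simp add: p(2) m_def[symmetric] power2_eq_square)
  qed
  moreover have "(\<Sum>i\<in>I. p i * (d i)\<^sup>2) \<le> A\<^sup>2"
    by (rule sq) (use d AB(1) in auto)
  ultimately have var: "(\<Sum>i\<in>I. p i * (d i - m)\<^sup>2) \<le> A\<^sup>2"
    using zero_le_power2[of m] by linarith
  have "((\<Sum>i\<in>I. p i * d i * y i) - m * (\<Sum>i\<in>I. p i * y i))\<^sup>2
      = (\<Sum>i\<in>I. (sqrt (p i) * (d i - m)) * (sqrt (p i) * y i))\<^sup>2"
  proof -
    have "(sqrt (p i) * (d i - m)) * (sqrt (p i) * y i) = p i * d i * y i - m * (p i * y i)"
      if "i \<in> I" for i
    proof -
      have "(sqrt (p i) * (d i - m)) * (sqrt (p i) * y i) = (sqrt (p i))\<^sup>2 * ((d i - m) * y i)"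
        by (simp add: power2_eq_square)
      then show ?thesis using p(1)[OF that] by (simp add: algebra_simps)
    qed
    then show ?thesis by (simp add: sum_subtractf sum_distrib_left)
  qed
  also have "\<dots> \<le> (\<Sum>i\<in>I. (sqrt (p i) * (d i - m))\<^sup>2) * (\<Sum>i\<in>I. (sqrt (p i) * y i)\<^sup>2)"
    by (rule Cauchy_Schwarz_ineq_sum)
  also have "\<dots> = (\<Sum>i\<in>I. p i * (d i - m)\<^sup>2) * (\<Sum>i\<in>I. p i * (y i)\<^sup>2)"
    using p(1) by (simp add: power_mult_distrib)
  also have "\<dots> \<le> A\<^sup>2 * B\<^sup>2"
    using p(1) by (intro mult_mono sum_nonneg var sq y AB) auto
  finally have "((\<Sum>i\<in>I. p i * d i * y i) - m * (\<Sum>i\<in>I. p i * y i))\<^sup>2 \<le> (A * B)\<^sup>2"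
    by (simp add: power_mult_distrib)
  then show ?thesis
    using AB by (simp add: m_def abs_le_square_iff[symmetric])
qed

text \<open>
  Along the segment from \<open>u\<close> to \<open>v\<close> the derivative of the softmax mean of \<open>y\<close> is the covariance
  of \<open>v - u\<close> and \<open>y\<close> under the softmax weights, so the mean value theorem and the covariance bound
  give the claim.
\<close>

lemma softmax_mean_lipschitz:
  assumes I: "finite I" "I \<noteq> {}"
    and uv: "\<And>i. i \<in> I \<Longrightarrow> \<bar>v i - u i\<bar> \<le> A" and y: "\<And>i. i \<in> I \<Longrightarrow> \<bar>y i\<bar> \<le> B"
    and AB: "0 \<le> A" "0 \<le> B"
  shows "\<bar>(\<Sum>i\<in>I. softmax I v i * y i) - (\<Sum>i\<in>I. softmax I u i * y i)\<bar> \<le> A * B"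
proof -
  define w where "w t i = u i + t * (v i - u i)" for t i
  define \<phi> where "\<phi> t = (\<Sum>i\<in>I. softmax I (w t) i * y i)" for t
  define \<phi>' where "\<phi>' t = (\<Sum>i\<in>I. softmax I (w t) i * (v i - u i) * y i)
      - (\<Sum>i\<in>I. softmax I (w t) i * (v i - u i)) * (\<Sum>i\<in>I. softmax I (w t) i * y i)" for t
  have \<phi>_eq: "\<phi> = (\<lambda>t. (\<Sum>i\<in>I. exp (w t i) * y i) / (\<Sum>i\<in>I. exp (w t i)))"
    by (auto simp: \<phi>_def softmax_def sum_divide_distrib)
  have der: "(\<phi> has_real_derivative \<phi>' t) (at t)" for t
  proof -
    define S where "S = (\<Sum>i\<in>I. exp (w t i))"
    have S: "S > 0" using sum_exp_pos[OF I] by (simp add: S_def)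
    define N where "N = (\<Sum>i\<in>I. exp (w t i) * y i)"
    define S' where "S' = (\<Sum>i\<in>I. exp (w t i) * (v i - u i))"
    define N' where "N' = (\<Sum>i\<in>I. exp (w t i) * (v i - u i) * y i)"
    have "((\<lambda>t. \<Sum>i\<in>I. exp (w t i)) has_real_derivative S') (at t)"
      unfolding w_def S'_def by (auto intro!: derivative_eq_intros sum.cong)
    moreover have "((\<lambda>t. \<Sum>i\<in>I. exp (w t i) * y i) has_real_derivative N') (at t)"
      unfolding w_def N'_def by (auto intro!: derivative_eq_intros sum.cong)
    ultimately have "(\<phi> has_real_derivative (N' * S - N * S') / (S * S)) (at t)"
      unfolding \<phi>_eq S_def N_def using S by (intro DERIV_divide) (auto simp: S_def)
    moreover have "\<phi>' t = N' / S - (S' / S) * (N / S)"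
      by (simp add: \<phi>'_def softmax_def N_def N'_def S'_def S_def[symmetric] sum_divide_distrib)
    moreover have "(N' * S - N * S') / (S * S) = N' / S - (S' / S) * (N / S)"
      using S by (simp add: field_simps)
    ultimately show ?thesis by simp
  qed
  obtain t where "\<phi> 1 - \<phi> 0 = \<phi>' t"
    using MVT2[of 0 1 \<phi> \<phi>'] der by auto
  moreover have "\<bar>\<phi>' t\<bar> \<le> A * B"
    unfolding \<phi>'_def
    by (rule covariance_bound) (auto simp: softmax_nonneg sum_softmax[OF I] uv y AB)
  moreover have "w 0 = u" "w 1 = v" by (auto simp: w_def)
  ultimately show ?thesis by (simp add: \<phi>_def)
qed

text \<open>
  The vector case reduces to the scalar one by pairing with the unit vector in the direction of the
  difference, which avoids the dependence on the dimension of a componentwise estimate.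
\<close>

lemma softmax_mean_lipschitz_vector:
  fixes g :: "'i \<Rightarrow> 'a::real_inner"
  assumes I: "finite I" "I \<noteq> {}"
    and uv: "\<And>i. i \<in> I \<Longrightarrow> \<bar>v i - u i\<bar> \<le> A" and g: "\<And>i. i \<in> I \<Longrightarrow> norm (g i) \<le> B"
    and AB: "0 \<le> A" "0 \<le> B"
  shows "norm ((\<Sum>i\<in>I. softmax I v i *\<^sub>R g i) - (\<Sum>i\<in>I. softmax I u i *\<^sub>R g i)) \<le> A * B"
proof -
  define D where "D = (\<Sum>i\<in>I. softmax I v i *\<^sub>R g i) - (\<Sum>i\<in>I. softmax I u i *\<^sub>R g i)"
  define e where "e = sgn D"
  have e: "norm e \<le> 1" by (simp add: e_def norm_sgn)
  have "norm D = e \<bullet> D"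
    by (cases "D = 0") (auto simp: e_def sgn_div_norm dot_square_norm power2_eq_square)
  also have "\<dots> = (\<Sum>i\<in>I. softmax I v i * (e \<bullet> g i)) - (\<Sum>i\<in>I. softmax I u i * (e \<bullet> g i))"
    by (simp add: D_def inner_diff_right inner_sum_right)
  also have "\<dots> \<le> \<bar>\<dots>\<bar>" by simp
  also have "\<dots> \<le> A * B"
  proof (rule softmax_mean_lipschitz[OF I uv _ AB])
    fix i assume i: "i \<in> I"
    have "\<bar>e \<bullet> g i\<bar> \<le> norm e * norm (g i)" by (rule Cauchy_Schwarz_ineq2)
    also have "\<dots> \<le> 1 * B" using e g[OF i] by (intro mult_mono) auto
    finally show "\<bar>e \<bullet> g i\<bar> \<le> B" by simp
  qed
  finally show ?thesis by (simp add: D_def)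
qed

section \<open>Subgradients of convex functions\<close>

text \<open>
  The derivative is only taken within \<open>X\<close>, so the argument runs along the segment from \<open>x\<close> to
  \<open>y\<close>: by convexity the difference quotients at \<open>x\<close> never exceed \<open>c y - c x\<close>.
\<close>

lemma convex_on_grad_le:
  fixes X :: "'a::euclidean_space set"
  assumes c: "convex_on X c" and xy: "x \<in> X" "y \<in> X" and g: "is_grad X c x g"
  shows "c x + g \<bullet> (y - x) \<le> c y"
proof -
  define l where "l t = x + t *\<^sub>R (y - x)" for t :: real
  have l_eq: "l t = (1 - t) *\<^sub>R x + t *\<^sub>R y" for t
    by (simp add: l_def algebra_simps)
  have img: "l ` {0..1} \<subseteq> X"
    using convex_on_imp_convex[OF c] xy by (auto simp: l_eq intro!: convexD)
  have "(c has_derivative (\<lambda>v. g \<bullet> v)) (at (l 0) within l ` {0..1})"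
    using g img unfolding is_grad_def by (auto simp: l_def intro: has_derivative_subset)
  moreover have "(l has_derivative (\<lambda>t. t *\<^sub>R (y - x))) (at 0 within {0..1})"
    unfolding l_def by (auto intro!: derivative_eq_intros)
  ultimately have "((c \<circ> l) has_derivative (\<lambda>t. t * (g \<bullet> (y - x)))) (at 0 within {0..1})"
    using diff_chain_within[of l _ 0 "{0..1}" c] by (fastforce simp: o_def)
  then have "((c \<circ> l) has_field_derivative g \<bullet> (y - x)) (at 0 within {0..1})"
    by (simp add: has_field_derivative_def mult_commute_abs)
  then have "((\<lambda>t. ((c \<circ> l) t - (c \<circ> l) 0) / (t - 0)) \<longlongrightarrow> g \<bullet> (y - x)) (at 0 within {0..1})"
    by (simp only: has_field_derivative_iff)
  moreover have "\<forall>\<^sub>F t in at 0 within {0..1}. ((c \<circ> l) t - (c \<circ> l) 0) / (t - 0) \<le> c y - c x"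
  proof -
    have "((c \<circ> l) t - (c \<circ> l) 0) / (t - 0) \<le> c y - c x" if "t \<in> {0..1}" "t \<noteq> 0" for t
    proof -
      have "c (l t) \<le> (1 - t) * c x + t * c y"
        unfolding l_eq using that xy by (intro convex_onD[OF c]) auto
      then show ?thesis using that by (simp add: field_simps l_def)
    qed
    then show ?thesis by (auto simp: eventually_at_filter)
  qed
  moreover have "at (0::real) within {0..1} \<noteq> bot"
    by (simp add: at_within_Icc_at_right)
  ultimately have "g \<bullet> (y - x) \<le> c y - c x"
    by (rule tendsto_upperbound)
  then show ?thesis by simp
qed

text \<open>
  The affine minorant at the convex combination \<open>z\<close>, averaged over \<open>x\<close> and \<open>y\<close>, loses its linear
  part.
\<close>

lemma convex_on_if_subgradients:
  fixes X :: "'a::real_inner set"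
  assumes X: "convex X"
    and sub: "\<And>x y. x \<in> X \<Longrightarrow> y \<in> X \<Longrightarrow> F x + g x \<bullet> (y - x) \<le> F y"
  shows "convex_on X F"
proof (rule convex_onI[OF _ X])
  fix t :: real and x y
  assume t: "0 < t" "t < 1" and xy: "x \<in> X" "y \<in> X"
  define z where "z = (1 - t) *\<^sub>R x + t *\<^sub>R y"
  have z: "z \<in> X" unfolding z_def using t xy X by (intro convexD) auto
  have "(1 - t) * (F z + g z \<bullet> (x - z)) + t * (F z + g z \<bullet> (y - z)) \<le> (1 - t) * F x + t * F y"
    using sub[OF z] xy t by (intro add_mono mult_left_mono) auto
  moreover have "(1 - t) * (F z + g z \<bullet> (x - z)) + t * (F z + g z \<bullet> (y - z))
      = F z + g z \<bullet> ((1 - t) *\<^sub>R (x - z) + t *\<^sub>R (y - z))"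
    by (simp add: inner_add_right algebra_simps)
  moreover have "(1 - t) *\<^sub>R (x - z) + t *\<^sub>R (y - z) = 0"
    by (simp add: z_def algebra_simps)
  ultimately show "F ((1 - t) *\<^sub>R x + t *\<^sub>R y) \<le> (1 - t) * F x + t * F y"
    by (simp add: z_def)
qed

text \<open>
  Subgradients at \<open>x\<close> and at \<open>y\<close> squeeze the Taylor remainder between \<open>0\<close> and
  \<open>(g y - g x) \<bullet> (y - x)\<close>, which is quadratic in \<open>y - x\<close>. Differentiability thus follows from
  inequalities alone, and inequalities survive integration: this replaces any differentiation under
  the integral sign.
\<close>

lemma is_grad_if_lipschitz_subgradients:
  fixes X :: "'a::euclidean_space set"
  assumes sub: "\<And>x y. x \<in> X \<Longrightarrow> y \<in> X \<Longrightarrow> F x + g x \<bullet> (y - x) \<le> F y"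
    and lip: "C-lipschitz_on X g" and x: "x \<in> X"
    and span: "g x \<in> span ((\<lambda>y. y - x) ` X)"
  shows "is_grad X F x (g x)"
proof -
  have rem: "\<bar>F y - F x - g x \<bullet> (y - x)\<bar> \<le> C * (norm (y - x))\<^sup>2" if y: "y \<in> X" for y
  proof -
    have "F y - F x - g x \<bullet> (y - x) \<le> (g y - g x) \<bullet> (y - x)"
      using sub[OF y x] by (simp add: inner_diff_left inner_diff_right)
    also have "\<dots> \<le> norm (g y - g x) * norm (y - x)" by (rule norm_cauchy_schwarz)
    also have "\<dots> \<le> (C * norm (y - x)) * norm (y - x)"
      using lipschitz_onD[OF lip y x] by (intro mult_right_mono) (auto simp: dist_norm)
    finally show ?thesis using sub[OF x y] by (simp add: power2_eq_square algebra_simps)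
  qed
  have "((\<lambda>y. (1 / norm (y - x)) *\<^sub>R (F y - (F x + g x \<bullet> (y - x)))) \<longlongrightarrow> 0) (at x within X)"
  proof (rule Lim_null_comparison)
    show "\<forall>\<^sub>F y in at x within X.
        norm ((1 / norm (y - x)) *\<^sub>R (F y - (F x + g x \<bullet> (y - x)))) \<le> C * norm (y - x)"
      using rem by (auto simp: eventually_at_filter power2_eq_square field_simps
          diff_diff_eq)
    have "((\<lambda>y. C * norm (y - x)) \<longlongrightarrow> C * norm (x - x)) (at x within X)"
      by (intro tendsto_intros)
    then show "((\<lambda>y. C * norm (y - x)) \<longlongrightarrow> 0) (at x within X)" by simp
  qed
  then show ?thesis
    using span by (simp add: is_grad_def has_derivative_within bounded_linear_inner_right)
qed

lemma is_grad_add: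
  assumes "is_grad X c x g" "is_grad X d x k"
  shows "is_grad X (\<lambda>y. c y + d y) x (g + k)"
  using assms unfolding is_grad_def inner_add_left
  by (auto intro: span_add has_derivative_add)

section \<open>Smoothing functions and log-sum-exp\<close>

lemma smoothing_functionD:
  assumes "smoothing_function X mubar c ct \<kappa> K L"
  shows "\<kappa> > 0" "L > 0"
    and "\<And>\<mu>. \<mu> \<in> {0<..mubar} \<Longrightarrow> (\<lambda>x. ct x \<mu>) differentiable_on X"
    and "\<And>x. x \<in> X \<Longrightarrow> ((\<lambda>(z, \<mu>). ct z \<mu>) \<longlongrightarrow> c x) (at (x, 0) within X \<times> {0<..mubar})"
    and "\<And>\<mu>. \<mu> \<in> {0<..mubar} \<Longrightarrow> convex_on X (\<lambda>x. ct x \<mu>)"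
    and "\<And>x \<mu>1 \<mu>2. x \<in> X \<Longrightarrow> \<mu>1 \<in> {0<..mubar} \<Longrightarrow> \<mu>2 \<in> {0<..mubar} \<Longrightarrow>
           \<bar>ct x \<mu>2 - ct x \<mu>1\<bar> \<le> \<kappa> * \<bar>\<mu>1 - \<mu>2\<bar>"
    and "\<And>\<mu>. \<mu> \<in> {0<..mubar} \<Longrightarrow> (K + L / \<mu>)-lipschitz_on X (grad X (\<lambda>x. ct x \<mu>))"
  using assms unfolding smoothing_function_def by blast+

lemma smoothing_function_is_grad:
  assumes sm: "smoothing_function X mubar c ct \<kappa> K L" and X: "convex X"
    and x: "x \<in> X" and \<mu>: "\<mu> \<in> {0<..mubar}"
  shows "is_grad X (\<lambda>y. ct y \<mu>) x (grad X (\<lambda>y. ct y \<mu>) x)"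
  using smoothing_functionD(3)[OF sm \<mu>] x X by (auto simp: differentiable_on_def intro: is_grad_grad)

lemma smoothing_function_grad_le:
  assumes sm: "smoothing_function X mubar c ct \<kappa> K L" and X: "convex X"
    and x: "x \<in> X" and y: "y \<in> X" and \<mu>: "\<mu> \<in> {0<..mubar}"
  shows "ct x \<mu> + grad X (\<lambda>y. ct y \<mu>) x \<bullet> (y - x) \<le> ct y \<mu>"
  using convex_on_grad_le[OF smoothing_functionD(5)[OF sm \<mu>] x y smoothing_function_is_grad[OF sm X x \<mu>]] .

text \<open>
  Let the second parameter of the Lipschitz condition in \<open>\<mu>\<close> tend to \<open>0\<close>.
\<close>

lemma smoothing_function_error:
  assumes sm: "smoothing_function X mubar c ct \<kappa> K L"
    and x: "x \<in> X" and \<mu>: "\<mu> \<in> {0<..mubar}"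
  shows "\<bar>ct x \<mu> - c x\<bar> \<le> \<kappa> * \<mu>"
proof -
  have ev: "\<forall>\<^sub>F \<nu> in at_right 0. \<nu> \<in> {0<..mubar}"
    using \<mu> by (auto simp: eventually_at_right_field intro!: exI[of _ mubar])
  have "((\<lambda>\<nu>. (x, \<nu>)) \<longlongrightarrow> (x, 0)) (at_right (0::real))"
    by (intro tendsto_intros)
  then have "filterlim (\<lambda>\<nu>. (x, \<nu>)) (at (x, 0) within X \<times> {0<..mubar}) (at_right 0)"
    using ev x by (auto simp: filterlim_at elim!: eventually_mono)
  from filterlim_compose[OF smoothing_functionD(4)[OF sm x] this]
  have lim: "((\<lambda>\<nu>. ct x \<nu>) \<longlongrightarrow> c x) (at_right 0)"
    by simp
  have "\<bar>ct x \<mu> - c x\<bar> \<le> \<kappa> * \<bar>0 - \<mu>\<bar>"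
  proof (rule tendsto_le)
    show "((\<lambda>\<nu>. \<bar>ct x \<mu> - ct x \<nu>\<bar>) \<longlongrightarrow> \<bar>ct x \<mu> - c x\<bar>) (at_right 0)"
      by (intro tendsto_intros lim)
    show "((\<lambda>\<nu>. \<kappa> * \<bar>\<nu> - \<mu>\<bar>) \<longlongrightarrow> \<kappa> * \<bar>0 - \<mu>\<bar>) (at_right 0)"
      by (intro tendsto_intros)
    show "\<forall>\<^sub>F \<nu> in at_right 0. \<bar>ct x \<mu> - ct x \<nu>\<bar> \<le> \<kappa> * \<bar>\<nu> - \<mu>\<bar>"
      using ev by eventually_elim (use smoothing_functionD(6)[OF sm x _ \<mu>] in auto)
  qed simp
  then show ?thesis using \<mu> by simp
qed

text \<open>
  To recognise a smoothing function it suffices to exhibit, for each \<open>\<mu>\<close>, a Lipschitz selection of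
  subgradients in the direction space of \<open>X\<close>; convexity, differentiability and the formula for the
  gradient come for free. Both log-sum-exp and its expectation are treated through this criterion.
\<close>

lemma smoothing_function_if_lipschitz_subgradients:
  fixes X :: "'a::euclidean_space set"
  assumes X: "convex X" and pos: "\<kappa> > 0" "L > 0"
    and lim: "\<And>x. x \<in> X \<Longrightarrow> ((\<lambda>(z, \<mu>). F z \<mu>) \<longlongrightarrow> c x) (at (x, 0) within X \<times> {0<..mubar})"
    and rate: "\<And>x \<mu>1 \<mu>2. x \<in> X \<Longrightarrow> \<mu>1 \<in> {0<..mubar} \<Longrightarrow> \<mu>2 \<in> {0<..mubar} \<Longrightarrow>
           \<bar>F x \<mu>2 - F x \<mu>1\<bar> \<le> \<kappa> * \<bar>\<mu>1 - \<mu>2\<bar>"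
    and sub: "\<And>x y \<mu>. x \<in> X \<Longrightarrow> y \<in> X \<Longrightarrow> \<mu> \<in> {0<..mubar} \<Longrightarrow> F x \<mu> + G \<mu> x \<bullet> (y - x) \<le> F y \<mu>"
    and lip: "\<And>\<mu>. \<mu> \<in> {0<..mubar} \<Longrightarrow> (K + L / \<mu>)-lipschitz_on X (G \<mu>)"
    and span: "\<And>x \<mu>. x \<in> X \<Longrightarrow> \<mu> \<in> {0<..mubar} \<Longrightarrow> G \<mu> x \<in> span ((\<lambda>y. y - x) ` X)"
  shows "smoothing_function X mubar c F \<kappa> K L"
    and "\<And>x \<mu>. x \<in> X \<Longrightarrow> \<mu> \<in> {0<..mubar} \<Longrightarrow> grad X (\<lambda>y. F y \<mu>) x = G \<mu> x"
proof -
  have G: "is_grad X (\<lambda>y. F y \<mu>) x (G \<mu> x)" if "x \<in> X" "\<mu> \<in> {0<..mubar}" for x \<mu>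
    using is_grad_if_lipschitz_subgradients[of X "\<lambda>y. F y \<mu>" "G \<mu>"] sub lip span that by blast
  show grad: "grad X (\<lambda>y. F y \<mu>) x = G \<mu> x" if "x \<in> X" "\<mu> \<in> {0<..mubar}" for x \<mu>
    using grad_eq[OF X _ G] that by blast
  have lip': "(K + L / \<mu>)-lipschitz_on X (grad X (\<lambda>y. F y \<mu>))" if \<mu>: "\<mu> \<in> {0<..mubar}" for \<mu>
    using lip[OF \<mu>] grad[OF _ \<mu>] by (simp cong: lipschitz_on_cong)
  show "smoothing_function X mubar c F \<kappa> K L"
    unfolding smoothing_function_def
  proof (intro conjI ballI)
    fix \<mu> assume \<mu>: "\<mu> \<in> {0<..mubar}"
    show "(\<lambda>x. F x \<mu>) differentiable_on X"
      using G[OF _ \<mu>] by (auto simp: differentiable_on_def is_grad_def differentiable_def)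
    show "continuous_on X (grad X (\<lambda>x. F x \<mu>))"
      using lip'[OF \<mu>] by (rule lipschitz_on_continuous_on)
    show "convex_on X (\<lambda>x. F x \<mu>)"
      using convex_on_if_subgradients[OF X, of "\<lambda>x. F x \<mu>" "G \<mu>"] sub[OF _ _ \<mu>] by blast
  qed (use pos lim rate lip' in auto)
qed

lemma tendsto_Max_image:
  fixes f :: "'i \<Rightarrow> 'b \<Rightarrow> 'c::linorder_topology"
  assumes "finite I" "I \<noteq> {}" "\<And>i. i \<in> I \<Longrightarrow> (f i \<longlongrightarrow> l i) F"
  shows "((\<lambda>x. Max ((\<lambda>i. f i x) ` I)) \<longlongrightarrow> Max (l ` I)) F"
  using assms
proof (induction I rule: finite_ne_induct)
  case (insert i I)
  then have "((\<lambda>x. max (f i x) (Max ((\<lambda>i. f i x) ` I))) \<longlongrightarrow> max (l i) (Max (l ` I))) F"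
    by (intro tendsto_max) auto
  then show ?case using insert.hyps by simp
qed simp

text \<open>
  The deterministic core: log-sum-exp turns smoothing functions of the \<open>c i\<close> into one of their
  maximum. The gradient is the softmax mean of the gradients. Between two points it changes for two
  reasons: the gradients change, which contributes \<open>K i + L i / \<mu>\<close>, and the weights change, which
  contributes \<open>(\<Sum>i. M i)\<^sup>2 / \<mu>\<close>, one factor coming from the variation of the exponents and one
  from the size of the gradients.
\<close>

lemma smoothing_function_scaled_lse:
  fixes X :: "'a::euclidean_space set" and c :: "'i \<Rightarrow> 'a \<Rightarrow> real"
    and ct :: "'i \<Rightarrow> 'a \<Rightarrow> real \<Rightarrow> real"
  assumes I: "finite I" "I \<noteq> {}" and X: "convex X"
    and sm: "\<And>i. i \<in> I \<Longrightarrow> smoothing_function X mubar (c i) (ct i) (\<kappa> i) (K i) (L i)"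
    and M: "\<And>i. i \<in> I \<Longrightarrow> 0 \<le> M i"
      "\<And>i x \<mu>. i \<in> I \<Longrightarrow> x \<in> X \<Longrightarrow> \<mu> \<in> {0<..mubar} \<Longrightarrow> norm (grad X (\<lambda>y. ct i y \<mu>) x) \<le> M i"
  shows "smoothing_function X mubar (\<lambda>x. Max ((\<lambda>i. c i x) ` I)) (\<lambda>x \<mu>. \<mu> * lse I (\<lambda>i. ct i x \<mu> / \<mu>))
           (ln (real (card I)) + sqrt (\<Sum>i\<in>I. (\<kappa> i)\<^sup>2)) (\<Sum>i\<in>I. K i) ((\<Sum>i\<in>I. M i)\<^sup>2 + (\<Sum>i\<in>I. L i))"
      (is ?smooth)
    and "\<And>x \<mu>. x \<in> X \<Longrightarrow> \<mu> \<in> {0<..mubar} \<Longrightarrow>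
           grad X (\<lambda>y. \<mu> * lse I (\<lambda>i. ct i y \<mu> / \<mu>)) x
             = (\<Sum>i\<in>I. softmax I (\<lambda>i. ct i x \<mu> / \<mu>) i *\<^sub>R grad X (\<lambda>y. ct i y \<mu>) x)"
      (is "\<And>x \<mu>. _ \<Longrightarrow> _ \<Longrightarrow> ?grad x \<mu>")
proof -
  define g where "g i \<mu> = grad X (\<lambda>y. ct i y \<mu>)" for i \<mu>
  define p where "p \<mu> x = softmax I (\<lambda>i. ct i x \<mu> / \<mu>)" for \<mu> x
  define G where "G \<mu> x = (\<Sum>i\<in>I. p \<mu> x i *\<^sub>R g i \<mu> x)" for \<mu> x
  define F where "F x \<mu> = \<mu> * lse I (\<lambda>i. ct i x \<mu> / \<mu>)" for x \<mu>
  define S where "S = (\<Sum>i\<in>I. M i)"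
  have p: "p \<mu> x i \<ge> 0" "sum (p \<mu> x) I = 1" for \<mu> x i
    using sum_softmax[OF I] by (auto simp: p_def softmax_nonneg)
  have S: "0 \<le> S" "M i \<le> S" if "i \<in> I" for i
    using that M(1) I by (auto simp: S_def intro: sum_nonneg member_le_sum)
  have S0: "0 \<le> S" using M(1) by (auto simp: S_def intro: sum_nonneg)
  have tangent: "ct i x \<mu> + g i \<mu> x \<bullet> (y - x) \<le> ct i y \<mu>"
    if "i \<in> I" "x \<in> X" "y \<in> X" "\<mu> \<in> {0<..mubar}" for i x y \<mu>
    unfolding g_def using smoothing_function_grad_le[OF sm X] that by blast
  have ct_lip: "\<bar>ct i x \<mu> - ct i y \<mu>\<bar> \<le> S * norm (x - y)"
    if "i \<in> I" "x \<in> X" "y \<in> X" "\<mu> \<in> {0<..mubar}" for i x y \<mu>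
  proof -
    have half: "ct i x \<mu> - ct i y \<mu> \<le> S * norm (x - y)" if xy: "x \<in> X" "y \<in> X" for x y
    proof -
      have "ct i x \<mu> - ct i y \<mu> \<le> g i \<mu> x \<bullet> (x - y)"
        using tangent[OF \<open>i \<in> I\<close> xy \<open>\<mu> \<in> _\<close>] by (simp add: inner_diff_right)
      also have "\<dots> \<le> norm (g i \<mu> x) * norm (x - y)" by (rule norm_cauchy_schwarz)
      also have "\<dots> \<le> S * norm (x - y)"
        using M(2)[OF \<open>i \<in> I\<close> xy(1) \<open>\<mu> \<in> _\<close>] S[OF \<open>i \<in> I\<close>]
        by (intro mult_right_mono) (auto simp: g_def)
      finally show ?thesis .
    qed
    show ?thesis
      using half[of x y] half[of y x] that by (auto simp: abs_le_iff norm_minus_commute)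
  qed
  have L: "(\<Sum>i\<in>I. L i) > 0" using I smoothing_functionD(2)[OF sm] by (intro sum_pos) auto
  have \<kappa>_le: "\<kappa> i \<le> sqrt (\<Sum>i\<in>I. (\<kappa> i)\<^sup>2)" if "i \<in> I" for i
    using I that by (intro real_le_rsqrt member_le_sum) auto
  have \<kappa>_pos: "sqrt (\<Sum>i\<in>I. (\<kappa> i)\<^sup>2) > 0"
  proof -
    obtain i where "i \<in> I" using I by blast
    then show ?thesis using \<kappa>_le smoothing_functionD(1)[OF sm] less_le_trans by blast
  qed
  have card: "ln (real (card I)) \<ge> 0"
    using I by (simp add: Suc_leI card_gt_0_iff)
  note smooth = smoothing_function_if_lipschitz_subgradients[
      where c = "\<lambda>x. Max ((\<lambda>i. c i x) ` I)" and F = F and G = G and X = X and mubar = mubar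
        and \<kappa> = "ln (real (card I)) + sqrt (\<Sum>i\<in>I. (\<kappa> i)\<^sup>2)"
        and K = "\<Sum>i\<in>I. K i" and L = "S\<^sup>2 + (\<Sum>i\<in>I. L i)"]
  have kpos: "0 < ln (real (card I)) + sqrt (\<Sum>i\<in>I. (\<kappa> i)\<^sup>2)"
    using card \<kappa>_pos by linarith
  have Lpos: "0 < S\<^sup>2 + (\<Sum>i\<in>I. L i)" using L by (simp add: add_nonneg_pos)
  have lim: "((\<lambda>(z, \<mu>). F z \<mu>) \<longlongrightarrow> Max ((\<lambda>i. c i x) ` I)) (at (x, 0) within X \<times> {0<..mubar})"
    if x: "x \<in> X" for x
  proof -
    let ?A = "at (x, 0) within X \<times> {0<..mubar}"
    have M: "((\<lambda>z. Max ((\<lambda>i. ct i (fst z) (snd z)) ` I)) \<longlongrightarrow> Max ((\<lambda>i. c i x) ` I)) ?A"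
      using smoothing_functionD(4)[OF sm x]
      by (intro tendsto_Max_image[OF I]) (auto simp: case_prod_beta')
    have \<mu>: "((\<lambda>z. snd z) \<longlongrightarrow> snd (x, 0 :: real)) ?A"
      by (intro tendsto_intros)
    have "((\<lambda>z. Max ((\<lambda>i. ct i (fst z) (snd z)) ` I) + snd z * ln (real (card I)))
        \<longlongrightarrow> Max ((\<lambda>i. c i x) ` I) + snd (x, 0 :: real) * ln (real (card I))) ?A"
      by (intro tendsto_add tendsto_mult M \<mu> tendsto_const)
    then have U: "((\<lambda>z. Max ((\<lambda>i. ct i (fst z) (snd z)) ` I) + snd z * ln (real (card I)))
        \<longlongrightarrow> Max ((\<lambda>i. c i x) ` I)) ?A" by simp
    show ?thesis
      unfolding case_prod_beta' F_def
    proof (rule tendsto_sandwich[OF _ _ M U])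
      show "\<forall>\<^sub>F z in ?A. Max ((\<lambda>i. ct i (fst z) (snd z)) ` I)
          \<le> snd z * lse I (\<lambda>i. ct i (fst z) (snd z) / snd z)"
        unfolding eventually_at_filter
        by (intro always_eventually allI impI scaled_lse_Max_bounds(1)[OF I]) auto
      show "\<forall>\<^sub>F z in ?A. snd z * lse I (\<lambda>i. ct i (fst z) (snd z) / snd z)
          \<le> Max ((\<lambda>i. ct i (fst z) (snd z)) ` I) + snd z * ln (real (card I))"
        unfolding eventually_at_filter
        by (intro always_eventually allI impI scaled_lse_Max_bounds(2)[OF I]) auto
    qed
  qed
  have rate: "\<bar>F x \<mu>2 - F x \<mu>1\<bar> \<le> (ln (real (card I)) + sqrt (\<Sum>i\<in>I. (\<kappa> i)\<^sup>2)) * \<bar>\<mu>1 - \<mu>2\<bar>"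
    if x: "x \<in> X" and \<mu>: "\<mu>1 \<in> {0<..mubar}" "\<mu>2 \<in> {0<..mubar}" for x \<mu>1 \<mu>2
  proof -
    have "\<bar>ct i x \<mu>2 - ct i x \<mu>1\<bar> \<le> sqrt (\<Sum>i\<in>I. (\<kappa> i)\<^sup>2) * \<bar>\<mu>1 - \<mu>2\<bar>" if i: "i \<in> I" for i
    proof -
      have "\<bar>ct i x \<mu>2 - ct i x \<mu>1\<bar> \<le> \<kappa> i * \<bar>\<mu>1 - \<mu>2\<bar>"
        by (rule smoothing_functionD(6)[OF sm[OF i] x \<mu>])
      also have "\<dots> \<le> sqrt (\<Sum>i\<in>I. (\<kappa> i)\<^sup>2) * \<bar>\<mu>1 - \<mu>2\<bar>"
        by (intro mult_right_mono \<kappa>_le i) simp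
      finally show ?thesis .
    qed
    from scaled_lse_lipschitz[OF I _ _ this, of \<mu>1 \<mu>2] show ?thesis
      using \<mu> by (simp add: F_def algebra_simps)
  qed
  have sub: "F x \<mu> + G \<mu> x \<bullet> (y - x) \<le> F y \<mu>"
    if x: "x \<in> X" and y: "y \<in> X" and \<mu>: "\<mu> \<in> {0<..mubar}" for x y \<mu>
  proof -
    have "G \<mu> x \<bullet> (y - x) \<le> (\<Sum>i\<in>I. p \<mu> x i * (ct i y \<mu> - ct i x \<mu>))"
      unfolding G_def inner_sum_left
    proof (rule sum_mono)
      fix i assume i: "i \<in> I"
      have "g i \<mu> x \<bullet> (y - x) \<le> ct i y \<mu> - ct i x \<mu>"
        using tangent[OF i x y \<mu>] by simp
      then show "(p \<mu> x i *\<^sub>R g i \<mu> x) \<bullet> (y - x) \<le> p \<mu> x i * (ct i y \<mu> - ct i x \<mu>)"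
        using p by (simp add: mult_left_mono)
    qed
    moreover have "F x \<mu> + (\<Sum>i\<in>I. p \<mu> x i * (ct i y \<mu> - ct i x \<mu>)) \<le> F y \<mu>"
      using scaled_lse_tangent[OF I, of \<mu> \<mu> "\<lambda>i. ct i x \<mu>" "\<lambda>i. ct i y \<mu>"] \<mu>
      by (simp add: F_def p_def)
    ultimately show ?thesis by linarith
  qed
  have lip: "((\<Sum>i\<in>I. K i) + (S\<^sup>2 + (\<Sum>i\<in>I. L i)) / \<mu>)-lipschitz_on X (G \<mu>)"
    if \<mu>: "\<mu> \<in> {0<..mubar}" for \<mu>
  proof -
    define C where "C i = K i + L i / \<mu>" for i
    have C: "C i \<ge> 0" "(C i)-lipschitz_on X (g i \<mu>)" if "i \<in> I" for i
      using smoothing_functionD(7)[OF sm[OF that] \<mu>] lipschitz_on_nonneg by (auto simp: C_def g_def)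
    have split: "(\<Sum>i\<in>I. K i) + (S\<^sup>2 + (\<Sum>i\<in>I. L i)) / \<mu> = (\<Sum>i\<in>I. C i) + S\<^sup>2 / \<mu>"
      by (simp add: C_def sum.distrib sum_divide_distrib add_divide_distrib)
    show ?thesis
      unfolding split
    proof (rule lipschitz_onI)
      fix x y assume x: "x \<in> X" and y: "y \<in> X"
      \<comment> \<open>Each \<open>C i\<close> is nonnegative, although \<open>K i\<close> need not be, so a mean of them is at most their sum.\<close>
      have "norm (\<Sum>i\<in>I. p \<mu> x i *\<^sub>R (g i \<mu> x - g i \<mu> y)) \<le> (\<Sum>i\<in>I. p \<mu> x i * norm (g i \<mu> x - g i \<mu> y))"
        using p by (intro sum_norm_le) simp
      also have "\<dots> \<le> (\<Sum>i\<in>I. C i) * norm (x - y)"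
      proof (rule weighted_mean_le[OF p])
        fix i assume i: "i \<in> I"
        have "norm (g i \<mu> x - g i \<mu> y) \<le> C i * norm (x - y)"
          using lipschitz_onD[OF C(2)[OF i] x y] by (simp add: dist_norm)
        also have "\<dots> \<le> (\<Sum>i\<in>I. C i) * norm (x - y)"
          using C(1) I i by (intro mult_right_mono member_le_sum) auto
        finally show "norm (g i \<mu> x - g i \<mu> y) \<le> (\<Sum>i\<in>I. C i) * norm (x - y)" .
      qed
      finally have 1: "norm (\<Sum>i\<in>I. p \<mu> x i *\<^sub>R (g i \<mu> x - g i \<mu> y)) \<le> (\<Sum>i\<in>I. C i) * norm (x - y)" .
      have 2: "norm ((\<Sum>i\<in>I. p \<mu> x i *\<^sub>R g i \<mu> y) - (\<Sum>i\<in>I. p \<mu> y i *\<^sub>R g i \<mu> y))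
          \<le> (S * norm (x - y) / \<mu>) * S"
        unfolding p_def
      proof (rule softmax_mean_lipschitz_vector[OF I])
        fix i assume i: "i \<in> I"
        show "\<bar>ct i x \<mu> / \<mu> - ct i y \<mu> / \<mu>\<bar> \<le> S * norm (x - y) / \<mu>"
          using ct_lip[OF i x y \<mu>] \<mu>
          by (simp add: diff_divide_distrib[symmetric] abs_divide divide_right_mono)
        show "norm (g i \<mu> y) \<le> S"
          using M(2)[OF i y \<mu>] S[OF i] by (simp add: g_def)
      qed (use S0 \<mu> in auto)
      have "G \<mu> x - G \<mu> y = (\<Sum>i\<in>I. p \<mu> x i *\<^sub>R (g i \<mu> x - g i \<mu> y))
          + ((\<Sum>i\<in>I. p \<mu> x i *\<^sub>R g i \<mu> y) - (\<Sum>i\<in>I. p \<mu> y i *\<^sub>R g i \<mu> y))"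
        by (simp add: G_def scaleR_diff_right sum_subtractf)
      then have "norm (G \<mu> x - G \<mu> y) \<le> (\<Sum>i\<in>I. C i) * norm (x - y) + (S * norm (x - y) / \<mu>) * S"
        using norm_triangle_mono[OF 1 2] by simp
      then show "dist (G \<mu> x) (G \<mu> y) \<le> ((\<Sum>i\<in>I. C i) + S\<^sup>2 / \<mu>) * dist x y"
        by (simp add: dist_norm power2_eq_square algebra_simps)
    next
      show "0 \<le> (\<Sum>i\<in>I. C i) + S\<^sup>2 / \<mu>"
        using \<mu> C(1) by (intro add_nonneg_nonneg sum_nonneg) auto
    qed
  qed
  have span: "G \<mu> x \<in> span ((\<lambda>y. y - x) ` X)" if "x \<in> X" "\<mu> \<in> {0<..mubar}" for x \<mu>
    unfolding G_def g_def using smoothing_function_is_grad[OF sm X that]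
    by (intro span_sum span_mul) (auto simp: is_grad_def)
  show ?smooth
    using smooth(1)[OF X kpos Lpos lim rate sub lip span] by (simp add: F_def[abs_def] S_def)
  show "?grad x \<mu>" if "x \<in> X" "\<mu> \<in> {0<..mubar}" for x \<mu>
    using smooth(2)[OF X kpos Lpos lim rate sub lip span that] by (simp add: F_def G_def g_def p_def)
qed

section \<open>Expectations of smoothing functions\<close>

text \<open>
  The complement of the support is covered by the null sets of a countable base of the topology.
\<close>

lemma AE_in_law_support:
  fixes P :: "'m::second_countable_topology measure"
  assumes "sets P = sets borel"
  shows "AE s in P. s \<in> law_support P"
proof -
  obtain B :: "'m set set" where B: "countable B" "topological_basis B"
    using ex_countable_basis by blast
  define N where "N = {b \<in> B. emeasure P b = 0}"
  have "(\<Union>b\<in>N. b) \<in> null_sets P"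
  proof (rule null_sets_UN')
    show "countable N" using B(1) by (simp add: N_def)
    show "b \<in> null_sets P" if "b \<in> N" for b
      using that assms topological_basis_open[OF B(2)] by (auto simp: N_def null_sets_def)
  qed
  moreover have "{s \<in> space P. s \<notin> law_support P} \<subseteq> (\<Union>b\<in>N. b)"
  proof
    fix s assume "s \<in> {s \<in> space P. s \<notin> law_support P}"
    then obtain U where U: "open U" "s \<in> U" "emeasure P U = 0"
      by (auto simp: law_support_def)
    obtain b where b: "b \<in> B" "s \<in> b" "b \<subseteq> U"
      using topological_basisE[OF B(2) U(1,2)] by blast
    have "emeasure P b \<le> emeasure P U" using b U assms by (intro emeasure_mono) auto
    then have "b \<in> N" using U b by (simp add: N_def)
    then show "s \<in> (\<Union>b\<in>N. b)" using b by blast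
  qed
  ultimately show ?thesis by (rule AE_I')
qed

text \<open>
  The gradient relative to \<open>X\<close> has to lie in the direction space of \<open>X\<close>; this is preserved by
  expectations, since the component of the expectation orthogonal to \<open>V\<close> is orthogonal to itself.
\<close>

lemma (in prob_space) expectation_in_subspace:
  fixes g :: "'a \<Rightarrow> 'b::euclidean_space"
  assumes g: "integrable M g" and V: "subspace V" and AE: "AE \<omega> in M. g \<omega> \<in> V"
  shows "expectation g \<in> V"
proof -
  obtain v z where vz: "v \<in> V" "\<And>w. w \<in> V \<Longrightarrow> orthogonal z w" "expectation g = v + z"
    using orthogonal_subspace_decomp_exists[of V "expectation g"] V by (metis span_eq_iff)
  have "z \<bullet> expectation g = expectation (\<lambda>\<omega>. z \<bullet> g \<omega>)"
    using g by simp
  also have "\<dots> = expectation (\<lambda>\<omega>. 0)"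
    using AE g vz(2) by (intro integral_cong_AE) (auto simp: orthogonal_def)
  finally have "z \<bullet> (v + z) = 0" by (simp add: vz(3))
  then have "z = 0" using vz(1,2) by (simp add: inner_add_right orthogonal_def)
  then show ?thesis using vz by simp
qed

lemma (in prob_space) expectation_pos:
  fixes f :: "'a \<Rightarrow> real"
  assumes "integrable M f" "AE \<omega> in M. 0 < f \<omega>"
  shows "0 < expectation f"
  using integral_less_AE_space[of "\<lambda>_. 0" f] assms by (simp add: emeasure_space_1)

lemma integral_norm_le_AE:
  fixes f :: "'a \<Rightarrow> 'b::{banach, second_countable_topology}"
  assumes "integrable M f" "integrable M g" "AE \<omega> in M. norm (f \<omega>) \<le> g \<omega>"
  shows "norm (\<integral>\<omega>. f \<omega> \<partial>M) \<le> (\<integral>\<omega>. g \<omega> \<partial>M)"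
proof -
  have "norm (\<integral>\<omega>. f \<omega> \<partial>M) \<le> (\<integral>\<omega>. norm (f \<omega>) \<partial>M)" by (rule integral_norm_bound)
  also have "\<dots> \<le> (\<integral>\<omega>. g \<omega> \<partial>M)" using assms by (intro integral_mono_AE) auto
  finally show ?thesis .
qed

text \<open>
  Expectations of smoothing functions are smoothing functions with the expected parameters. Everything
  except the limit condition is a pointwise inequality that is integrated. The limit needs a
  modulus uniform in \<open>x\<close>: the expectation of \<open>F\<close> is within \<open>E \<kappa> * \<mu>\<close> of that of \<open>c\<close>, and the latter
  is continuous. The gradients of \<open>F\<close> enter through a measurable version \<open>g\<close>, because a function
  that equals a measurable one almost everywhere need not be measurable itself.
\<close>

lemma (in prob_space) smoothing_function_expectation:
  fixes X :: "'x::euclidean_space set"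
    and c :: "'x \<Rightarrow> 'a \<Rightarrow> real" and F :: "'x \<Rightarrow> real \<Rightarrow> 'a \<Rightarrow> real"
    and g :: "'x \<Rightarrow> real \<Rightarrow> 'a \<Rightarrow> 'x"
  assumes X: "convex X"
    and sm: "AE \<xi> in M. smoothing_function X mubar (\<lambda>x. c x \<xi>) (\<lambda>x \<mu>. F x \<mu> \<xi>) (\<kappa> \<xi>) (K \<xi>) (L \<xi>)"
    and int: "integrable M \<kappa>" "integrable M K" "integrable M L"
    and c_int: "\<And>x. x \<in> X \<Longrightarrow> integrable M (c x)"
    and c_cont: "continuous_on X (\<lambda>x. expectation (c x))"
    and F_meas: "\<And>x \<mu>. x \<in> X \<Longrightarrow> \<mu> \<in> {0<..mubar} \<Longrightarrow> F x \<mu> \<in> borel_measurable M"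
    and grad_int: "\<And>x \<mu>. x \<in> X \<Longrightarrow> \<mu> \<in> {0<..mubar} \<Longrightarrow> integrable M (g x \<mu>)"
    and grad_eq: "\<And>x \<mu>. x \<in> X \<Longrightarrow> \<mu> \<in> {0<..mubar} \<Longrightarrow>
           AE \<xi> in M. grad X (\<lambda>y. F y \<mu> \<xi>) x = g x \<mu> \<xi>"
  shows "\<And>x \<mu>. x \<in> X \<Longrightarrow> \<mu> \<in> {0<..mubar} \<Longrightarrow> integrable M (F x \<mu>)"
    and "smoothing_function X mubar (\<lambda>x. expectation (c x)) (\<lambda>x \<mu>. expectation (F x \<mu>))
           (expectation \<kappa>) (expectation K) (expectation L)"
    and "\<And>x \<mu>. x \<in> X \<Longrightarrow> \<mu> \<in> {0<..mubar} \<Longrightarrow>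
           grad X (\<lambda>y. expectation (F y \<mu>)) x = expectation (g x \<mu>)"
proof -
  define G where "G \<mu> x = expectation (g x \<mu>)" for \<mu> x
  have err: "AE \<xi> in M. \<bar>F x \<mu> \<xi> - c x \<xi>\<bar> \<le> \<kappa> \<xi> * \<mu>" if "x \<in> X" "\<mu> \<in> {0<..mubar}" for x \<mu>
    using sm by eventually_elim (use smoothing_function_error that in blast)
  show F_int: "integrable M (F x \<mu>)" if x: "x \<in> X" and \<mu>: "\<mu> \<in> {0<..mubar}" for x \<mu>
  proof (rule Bochner_Integration.integrable_bound)
    show "integrable M (\<lambda>\<xi>. \<bar>c x \<xi>\<bar> + \<kappa> \<xi> * \<mu>)"
      using c_int[OF x] int(1) by simp
    show "AE \<xi> in M. norm (F x \<mu> \<xi>) \<le> norm (\<bar>c x \<xi>\<bar> + \<kappa> \<xi> * \<mu>)"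
      using err[OF x \<mu>] by eventually_elim auto
  qed (rule F_meas[OF x \<mu>])
  have pos: "expectation \<kappa> > 0" "expectation L > 0"
    using sm int(1,3) by (auto intro!: expectation_pos simp: smoothing_function_def elim!: eventually_mono)
  have lim: "((\<lambda>(z, \<mu>). expectation (F z \<mu>)) \<longlongrightarrow> expectation (c x)) (at (x, 0) within X \<times> {0<..mubar})"
    if x: "x \<in> X" for x
  proof -
    let ?A = "at (x, 0) within X \<times> {0<..mubar}"
    have in_dom: "\<forall>\<^sub>F z in ?A. fst z \<in> X \<and> snd z \<in> {0<..mubar}"
      unfolding eventually_at_filter by (rule always_eventually) auto
    have snd0: "((\<lambda>z. snd z) \<longlongrightarrow> snd (x, 0 :: real)) ?A" and fst: "((\<lambda>z. fst z) \<longlongrightarrow> fst (x, 0 :: real)) ?A"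
      by (intro tendsto_intros)+
    have "((\<lambda>z. expectation (c (fst z))) \<longlongrightarrow> expectation (c (fst (x, 0::real)))) ?A"
      using in_dom x by (intro continuous_on_tendsto_compose[OF c_cont fst]) (auto elim: eventually_mono)
    then have c_lim: "((\<lambda>z. expectation (c (fst z))) \<longlongrightarrow> expectation (c x)) ?A"
      by simp
    have "((\<lambda>z. expectation (F (fst z) (snd z)) - expectation (c (fst z))) \<longlongrightarrow> 0) ?A"
    proof (rule Lim_null_comparison)
      show "\<forall>\<^sub>F z in ?A. norm (expectation (F (fst z) (snd z)) - expectation (c (fst z)))
          \<le> expectation \<kappa> * snd z"
        using in_dom
      proof eventually_elim
        case (elim z)
        then have "norm (expectation (\<lambda>\<xi>. F (fst z) (snd z) \<xi> - c (fst z) \<xi>))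
            \<le> expectation (\<lambda>\<xi>. \<kappa> \<xi> * snd z)"
          using F_int c_int int(1) err[of "fst z" "snd z"]
          by (intro integral_norm_le_AE) auto
        then show ?case using elim F_int c_int int(1) by simp
      qed
      have "((\<lambda>z. expectation \<kappa> * snd z) \<longlongrightarrow> expectation \<kappa> * snd (x, 0 :: real)) ?A"
        by (intro tendsto_mult tendsto_const snd0)
      then show "((\<lambda>z. expectation \<kappa> * snd z) \<longlongrightarrow> 0) ?A" by simp
    qed
    from tendsto_add[OF this c_lim] show ?thesis by (simp add: case_prod_beta')
  qed
  have rate: "\<bar>expectation (F x \<mu>2) - expectation (F x \<mu>1)\<bar> \<le> expectation \<kappa> * \<bar>\<mu>1 - \<mu>2\<bar>"
    if x: "x \<in> X" and \<mu>: "\<mu>1 \<in> {0<..mubar}" "\<mu>2 \<in> {0<..mubar}" for x \<mu>1 \<mu>2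
  proof -
    have "AE \<xi> in M. \<bar>F x \<mu>2 \<xi> - F x \<mu>1 \<xi>\<bar> \<le> \<kappa> \<xi> * \<bar>\<mu>1 - \<mu>2\<bar>"
      using sm by eventually_elim (use smoothing_functionD(6) x \<mu> in blast)
    then have "norm (expectation (\<lambda>\<xi>. F x \<mu>2 \<xi> - F x \<mu>1 \<xi>)) \<le> expectation (\<lambda>\<xi>. \<kappa> \<xi> * \<bar>\<mu>1 - \<mu>2\<bar>)"
      using F_int[OF x] \<mu> int(1) by (intro integral_norm_le_AE) auto
    then show ?thesis using F_int[OF x] \<mu> int(1) by simp
  qed
  have sub: "expectation (F x \<mu>) + G \<mu> x \<bullet> (y - x) \<le> expectation (F y \<mu>)"
    if x: "x \<in> X" and y: "y \<in> X" and \<mu>: "\<mu> \<in> {0<..mubar}" for x y \<mu>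
  proof -
    have "AE \<xi> in M. F x \<mu> \<xi> + grad X (\<lambda>y. F y \<mu> \<xi>) x \<bullet> (y - x) \<le> F y \<mu> \<xi>"
      using sm by eventually_elim (rule smoothing_function_grad_le[OF _ X x y \<mu>])
    then have "AE \<xi> in M. F x \<mu> \<xi> + g x \<mu> \<xi> \<bullet> (y - x) \<le> F y \<mu> \<xi>"
      using grad_eq[OF x \<mu>] by eventually_elim simp
    then have "expectation (\<lambda>\<xi>. F x \<mu> \<xi> + g x \<mu> \<xi> \<bullet> (y - x)) \<le> expectation (F y \<mu>)"
      using F_int[OF x \<mu>] F_int[OF y \<mu>] grad_int[OF x \<mu>] by (intro integral_mono_AE) auto
    then show ?thesis
      using F_int[OF x \<mu>] grad_int[OF x \<mu>] by (simp add: G_def)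
  qed
  have lip: "(expectation K + expectation L / \<mu>)-lipschitz_on X (G \<mu>)" if \<mu>: "\<mu> \<in> {0<..mubar}" for \<mu>
  proof -
    have C: "integrable M (\<lambda>\<xi>. K \<xi> + L \<xi> / \<mu>)"
      "expectation (\<lambda>\<xi>. K \<xi> + L \<xi> / \<mu>) = expectation K + expectation L / \<mu>"
      using int by simp_all
    have lipAE: "AE \<xi> in M. (K \<xi> + L \<xi> / \<mu>)-lipschitz_on X (grad X (\<lambda>y. F y \<mu> \<xi>))"
      using sm by eventually_elim (rule smoothing_functionD(7)[OF _ \<mu>])
    show ?thesis
      unfolding C(2)[symmetric]
    proof (rule lipschitz_onI)
      show "0 \<le> expectation (\<lambda>\<xi>. K \<xi> + L \<xi> / \<mu>)"
        using lipAE by (intro integral_nonneg_AE) (auto dest: lipschitz_on_nonneg elim: eventually_mono)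
      fix x y assume x: "x \<in> X" and y: "y \<in> X"
      have "AE \<xi> in M. norm (g x \<mu> \<xi> - g y \<mu> \<xi>) \<le> (K \<xi> + L \<xi> / \<mu>) * dist x y"
        using lipAE grad_eq[OF x \<mu>] grad_eq[OF y \<mu>]
        by eventually_elim (use lipschitz_onD x y in \<open>fastforce simp: dist_norm\<close>)
      then have "norm (expectation (\<lambda>\<xi>. g x \<mu> \<xi> - g y \<mu> \<xi>))
          \<le> expectation (\<lambda>\<xi>. (K \<xi> + L \<xi> / \<mu>) * dist x y)"
        using grad_int[OF x \<mu>] grad_int[OF y \<mu>] C(1)
        by (intro integral_norm_le_AE integrable_mult_left Bochner_Integration.integrable_diff) auto
      also have "\<dots> = expectation (\<lambda>\<xi>. K \<xi> + L \<xi> / \<mu>) * dist x y"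
        by (rule integral_mult_left_zero)
      finally show "dist (G \<mu> x) (G \<mu> y) \<le> expectation (\<lambda>\<xi>. K \<xi> + L \<xi> / \<mu>) * dist x y"
        using grad_int[OF x \<mu>] grad_int[OF y \<mu>] by (simp add: G_def dist_norm)
    qed
  qed
  have span: "G \<mu> x \<in> span ((\<lambda>y. y - x) ` X)" if x: "x \<in> X" and \<mu>: "\<mu> \<in> {0<..mubar}" for x \<mu>
    unfolding G_def
  proof (rule expectation_in_subspace[OF grad_int[OF x \<mu>] subspace_span])
    have "AE \<xi> in M. grad X (\<lambda>y. F y \<mu> \<xi>) x \<in> span ((\<lambda>y. y - x) ` X)"
      using sm by eventually_elim
        (rule conjunct1[OF smoothing_function_is_grad[OF _ X x \<mu>, unfolded is_grad_def]])
    then show "AE \<xi> in M. g x \<mu> \<xi> \<in> span ((\<lambda>y. y - x) ` X)"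
      using grad_eq[OF x \<mu>] by eventually_elim simp
  qed
  note smooth = smoothing_function_if_lipschitz_subgradients[
      where c = "\<lambda>x. expectation (c x)" and F = "\<lambda>x \<mu>. expectation (F x \<mu>)" and G = G
        and X = X and mubar = mubar]
  show "smoothing_function X mubar (\<lambda>x. expectation (c x)) (\<lambda>x \<mu>. expectation (F x \<mu>))
      (expectation \<kappa>) (expectation K) (expectation L)"
    by (rule smooth(1)[OF X pos lim rate sub lip span])
  show "grad X (\<lambda>y. expectation (F y \<mu>)) x = expectation (g x \<mu>)"
    if "x \<in> X" "\<mu> \<in> {0<..mubar}" for x \<mu>
    using smooth(2)[OF X pos lim rate sub lip span that] by (simp add: G_def)
qed

section \<open>Moments of mixtures\<close>

text \<open>
  Integrals under the law of a pair whose first component has law \<open>M\<close> and whose second component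
  takes the value \<open>i\<close> with conditional probability \<open>w \<xi> i\<close>, if the weights sum to one.
\<close>

lemma (in prob_space) mixture_integral:
  fixes F :: "'a \<Rightarrow> 'i \<Rightarrow> 'b::{banach, second_countable_topology}"
  assumes I: "finite I"
    and w: "\<And>i. i \<in> I \<Longrightarrow> (\<lambda>\<xi>. w \<xi> i) \<in> borel_measurable M" "\<And>\<xi> i. i \<in> I \<Longrightarrow> 0 \<le> w \<xi> i"
    and F: "\<And>i. i \<in> I \<Longrightarrow> (\<lambda>\<xi>. F \<xi> i) \<in> borel_measurable M"
    and int: "\<And>i. i \<in> I \<Longrightarrow> integrable M (\<lambda>\<xi>. w \<xi> i *\<^sub>R F \<xi> i)"
  defines "Q \<equiv> density (M \<Otimes>\<^sub>M count_space I) (\<lambda>(\<xi>, i). ennreal (w \<xi> i))"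
  shows "integrable Q (\<lambda>(\<xi>, i). F \<xi> i)"
    and "(\<integral>(\<xi>, i). F \<xi> i \<partial>Q) = (\<Sum>i\<in>I. \<integral>\<xi>. w \<xi> i *\<^sub>R F \<xi> i \<partial>M)"
proof -
  interpret I: sigma_finite_measure "count_space I"
    using I by (intro sigma_finite_measure_count_space_finite)
  interpret pair_sigma_finite M "count_space I" ..
  have Q: "Q = density (M \<Otimes>\<^sub>M count_space I) (\<lambda>z. ennreal (w (fst z) (snd z)))"
    by (simp add: Q_def case_prod_beta')
  have prod_meas: "(\<lambda>z. f (fst z) (snd z)) \<in> borel_measurable (M \<Otimes>\<^sub>M count_space I)"
    if "\<And>i. i \<in> I \<Longrightarrow> (\<lambda>\<xi>. f \<xi> i) \<in> borel_measurable M" for f :: "'a \<Rightarrow> 'i \<Rightarrow> 'c::topological_space"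
  proof (rule measurable_compose_countable'[where g = snd and I = I and f = "\<lambda>i z. f (fst z) i"])
    show "(\<lambda>z. f (fst z) i) \<in> borel_measurable (M \<Otimes>\<^sub>M count_space I)" if "i \<in> I" for i
      using measurable_compose[OF measurable_fst \<open>\<And>i. i \<in> I \<Longrightarrow> (\<lambda>\<xi>. f \<xi> i) \<in> borel_measurable M\<close>[OF that]] .
  qed (use I in \<open>auto intro: countable_finite\<close>)
  note wM = prod_meas[of w, OF w(1)] and FM = prod_meas[of F, OF F]
  have nn: "AE z in M \<Otimes>\<^sub>M count_space I. 0 \<le> w (fst z) (snd z)"
    using w(2) by (intro AE_I2) (auto simp: space_pair_measure)
  have prod_int: "integrable (M \<Otimes>\<^sub>M count_space I) (\<lambda>z. w (fst z) (snd z) *\<^sub>R F (fst z) (snd z))"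
  proof (rule Fubini_integrable)
    show "(\<lambda>z. w (fst z) (snd z) *\<^sub>R F (fst z) (snd z)) \<in> borel_measurable (M \<Otimes>\<^sub>M count_space I)"
      using wM FM by measurable
    show "integrable M (\<lambda>\<xi>. \<integral>i. norm (w (fst (\<xi>, i)) (snd (\<xi>, i)) *\<^sub>R F (fst (\<xi>, i)) (snd (\<xi>, i))) \<partial>count_space I)"
      using int I
      by (auto simp: lebesgue_integral_count_space_finite simp del: norm_scaleR
          intro!: Bochner_Integration.integrable_sum integrable_norm)
    show "AE \<xi> in M. integrable (count_space I)
        (\<lambda>i. w (fst (\<xi>, i)) (snd (\<xi>, i)) *\<^sub>R F (fst (\<xi>, i)) (snd (\<xi>, i)))"
      using I by (auto intro: integrable_count_space)
  qed
  show "integrable Q (\<lambda>(\<xi>, i). F \<xi> i)"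
    unfolding Q case_prod_beta' using integrable_density[OF FM wM nn] prod_int by simp
  have "(\<integral>(\<xi>, i). F \<xi> i \<partial>Q) = (\<integral>z. w (fst z) (snd z) *\<^sub>R F (fst z) (snd z) \<partial>(M \<Otimes>\<^sub>M count_space I))"
    unfolding Q case_prod_beta' by (rule integral_density[OF FM wM nn])
  also have "\<dots> = (\<integral>\<xi>. \<integral>i. w \<xi> i *\<^sub>R F \<xi> i \<partial>count_space I \<partial>M)"
    using integral_fst'[OF prod_int] by simp
  also have "\<dots> = (\<Sum>i\<in>I. \<integral>\<xi>. w \<xi> i *\<^sub>R F \<xi> i \<partial>M)"
    using int I by (simp add: lebesgue_integral_count_space_finite Bochner_Integration.integral_sum)
  finally show "(\<integral>(\<xi>, i). F \<xi> i \<partial>Q) = (\<Sum>i\<in>I. \<integral>\<xi>. w \<xi> i *\<^sub>R F \<xi> i \<partial>M)" .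
qed

lemma (in prob_space) prob_space_mixture:
  assumes I: "finite I"
    and w: "\<And>i. i \<in> I \<Longrightarrow> (\<lambda>\<xi>. w \<xi> i) \<in> borel_measurable M" "\<And>\<xi> i. i \<in> I \<Longrightarrow> 0 \<le> w \<xi> i"
      "\<And>\<xi>. (\<Sum>i\<in>I. w \<xi> i) = 1"
  shows "prob_space (density (M \<Otimes>\<^sub>M count_space I) (\<lambda>(\<xi>, i). ennreal (w \<xi> i)))" (is "prob_space ?Q")
proof -
  have int: "integrable M (\<lambda>\<xi>. w \<xi> i *\<^sub>R (1::real))" if i: "i \<in> I" for i
  proof (rule integrable_const_bound)
    have "w \<xi> i \<le> 1" for \<xi>
      using w(2,3) I i member_le_sum[of i I "w \<xi>"] by auto
    then show "AE \<xi> in M. norm (w \<xi> i *\<^sub>R (1::real)) \<le> 1"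
      using w(2)[OF i] by auto
  qed (use w(1)[OF i] in simp)
  note mix = mixture_integral[where F = "\<lambda>_ _. 1::real" and w = w, OF I w(1,2) _ int]
  have "integrable ?Q (\<lambda>_. 1::real)" using mix(1) by (simp add: case_prod_beta')
  then have "emeasure ?Q (space ?Q) < \<infinity>"
    by (simp add: integrable_iff_bounded)
  then interpret finite_measure ?Q
    by (intro finite_measureI) simp
  have "measure ?Q (space ?Q) = (\<Sum>i\<in>I. \<integral>\<xi>. w \<xi> i \<partial>M)"
    using mix(2) by (simp add: case_prod_beta')
  also have "\<dots> = (\<integral>\<xi>. (\<Sum>i\<in>I. w \<xi> i) \<partial>M)"
    using int by simp
  also have "\<dots> = 1" by (simp add: w(3) prob_space)
  finally show ?thesis by (intro prob_spaceI) (simp add: emeasure_eq_measure)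
qed

text \<open>
  Centring at the mean subtracts \<open>(norm (expectation Y))\<^sup>2\<close> from the second moment.
\<close>

lemma (in prob_space) variance_le_second_moment:
  fixes Y :: "'a \<Rightarrow> 'b::euclidean_space"
  assumes Y: "integrable M Y" "integrable M (\<lambda>\<omega>. (norm (Y \<omega>))\<^sup>2)"
  shows "integrable M (\<lambda>\<omega>. (norm (Y \<omega> - expectation Y))\<^sup>2)"
    and "expectation (\<lambda>\<omega>. (norm (Y \<omega> - expectation Y))\<^sup>2) \<le> expectation (\<lambda>\<omega>. (norm (Y \<omega>))\<^sup>2)"
proof -
  define m where "m = expectation Y"
  have eq: "(norm (Y \<omega> - m))\<^sup>2 = (norm (Y \<omega>))\<^sup>2 - 2 * (m \<bullet> Y \<omega>) + (norm m)\<^sup>2" for \<omega>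
    by (simp add: power2_norm_eq_inner inner_diff_left inner_diff_right inner_commute)
  have "integrable M (\<lambda>\<omega>. (norm (Y \<omega> - m))\<^sup>2)"
    unfolding eq using Y by simp
  then show "integrable M (\<lambda>\<omega>. (norm (Y \<omega> - expectation Y))\<^sup>2)" by (simp add: m_def)
  have "expectation (\<lambda>\<omega>. (norm (Y \<omega> - m))\<^sup>2) = expectation (\<lambda>\<omega>. (norm (Y \<omega>))\<^sup>2) - (norm m)\<^sup>2"
    unfolding eq using Y by (simp add: prob_space m_def[symmetric] power2_norm_eq_inner)
  then show "expectation (\<lambda>\<omega>. (norm (Y \<omega> - expectation Y))\<^sup>2) \<le> expectation (\<lambda>\<omega>. (norm (Y \<omega>))\<^sup>2)"
    by (simp add: m_def)
qed

text \<open>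
  Moments of a vector \<open>V \<xi> i\<close> under the mixture when \<open>norm (V \<xi> i) \<le> B i \<xi>\<close>. Since the weights
  sum to one, all second moments are controlled by the expectation of the square of the sum of the
  \<open>B i\<close>, an upper bound in which the weights no longer occur.
\<close>

lemma (in prob_space) mixture_mean_variance:
  fixes V :: "'a \<Rightarrow> 'i \<Rightarrow> 'b::euclidean_space"
  assumes I: "finite I"
    and w: "\<And>i. i \<in> I \<Longrightarrow> (\<lambda>\<xi>. w \<xi> i) \<in> borel_measurable M" "\<And>\<xi> i. i \<in> I \<Longrightarrow> 0 \<le> w \<xi> i"
      "\<And>\<xi>. (\<Sum>i\<in>I. w \<xi> i) = 1"
    and V: "\<And>i. i \<in> I \<Longrightarrow> (\<lambda>\<xi>. V \<xi> i) \<in> borel_measurable M"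
    and B: "\<And>i. i \<in> I \<Longrightarrow> B i \<in> borel_measurable M"
      "\<And>i. i \<in> I \<Longrightarrow> AE \<xi> in M. norm (V \<xi> i) \<le> B i \<xi>"
      "integrable M (\<lambda>\<xi>. (\<Sum>i\<in>I. B i \<xi>)\<^sup>2)"
  defines "Q \<equiv> density (M \<Otimes>\<^sub>M count_space I) (\<lambda>(\<xi>, i). ennreal (w \<xi> i))"
  defines "m \<equiv> expectation (\<lambda>\<xi>. \<Sum>i\<in>I. w \<xi> i *\<^sub>R V \<xi> i)"
  shows "integrable M (\<lambda>\<xi>. \<Sum>i\<in>I. w \<xi> i *\<^sub>R V \<xi> i)"
    and "prob_space Q"
    and "integrable Q (\<lambda>(\<xi>, i). V \<xi> i)"
    and "(\<integral>(\<xi>, i). V \<xi> i \<partial>Q) = m"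
    and "integrable Q (\<lambda>(\<xi>, i). (norm (V \<xi> i - m))\<^sup>2)"
    and "(\<integral>(\<xi>, i). (norm (V \<xi> i - m))\<^sup>2 \<partial>Q) \<le> (\<integral>(\<xi>, i). (B i \<xi>)\<^sup>2 \<partial>Q)"
    and "(\<integral>(\<xi>, i). (B i \<xi>)\<^sup>2 \<partial>Q) \<le> expectation (\<lambda>\<xi>. (\<Sum>i\<in>I. B i \<xi>)\<^sup>2)"
proof -
  define S where "S \<xi> = (\<Sum>i\<in>I. B i \<xi>)" for \<xi>
  have w_le: "w \<xi> i \<le> 1" if "i \<in> I" for \<xi> i
    using w(2,3) I that member_le_sum[of i I "w \<xi>"] by auto
  have S_meas: "S \<in> borel_measurable M"
    unfolding S_def using B(1) by measurable
  have bounds: "AE \<xi> in M. \<forall>i\<in>I. norm (V \<xi> i) \<le> B i \<xi> \<and> 0 \<le> B i \<xi> \<and> B i \<xi> \<le> S \<xi>"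
  proof -
    have "AE \<xi> in M. \<forall>i\<in>I. norm (V \<xi> i) \<le> B i \<xi>"
      using B(2) I by (intro AE_finite_allI) auto
    then show ?thesis
    proof eventually_elim
      case (elim \<xi>)
      then have "0 \<le> B i \<xi>" if "i \<in> I" for i
        using that norm_ge_zero order_trans by blast
      then show ?case using elim I by (auto simp: S_def intro!: member_le_sum)
    qed
  qed
  have S_int: "integrable M S"
  proof (rule Bochner_Integration.integrable_bound)
    show "integrable M (\<lambda>\<xi>. 1 + (S \<xi>)\<^sup>2)" using B(3) by (simp add: S_def)
    \<comment> \<open>Integrability of the square gives integrability itself, as \<open>M\<close> is finite.\<close>
    have "\<bar>s\<bar> \<le> 1 + s\<^sup>2" for s :: real
      using zero_le_power2[of "\<bar>s\<bar> - 1"] by (simp add: power2_diff)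
    then show "AE \<xi> in M. norm (S \<xi>) \<le> norm (1 + (S \<xi>)\<^sup>2)" by auto
  qed (rule S_meas)
  have weighted_int: "integrable M (\<lambda>\<xi>. w \<xi> i *\<^sub>R Y \<xi>)"
    if i: "i \<in> I" and Y: "Y \<in> borel_measurable M" and D: "integrable M D" "AE \<xi> in M. norm (Y \<xi>) \<le> D \<xi>"
    for i D and Y :: "'a \<Rightarrow> 'c::{banach, second_countable_topology}"
  proof (rule Bochner_Integration.integrable_bound[OF D(1)])
    show "(\<lambda>\<xi>. w \<xi> i *\<^sub>R Y \<xi>) \<in> borel_measurable M" using w(1)[OF i] Y by measurable
    show "AE \<xi> in M. norm (w \<xi> i *\<^sub>R Y \<xi>) \<le> norm (D \<xi>)"
      using D(2)
    proof eventually_elim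
      case (elim \<xi>)
      have "w \<xi> i * norm (Y \<xi>) \<le> 1 * norm (Y \<xi>)"
        using w_le[OF i] by (intro mult_right_mono) auto
      then show ?case using elim w(2)[OF i] by simp
    qed
  qed
  have V_int: "integrable M (\<lambda>\<xi>. w \<xi> i *\<^sub>R V \<xi> i)" if i: "i \<in> I" for i
    using bounds i by (intro weighted_int[OF i V[OF i] S_int]) (auto elim!: eventually_mono)
  have sq_int: "integrable M (\<lambda>\<xi>. w \<xi> i *\<^sub>R (b \<xi>)\<^sup>2)"
    if i: "i \<in> I" and b: "b \<in> borel_measurable M" "AE \<xi> in M. 0 \<le> b \<xi> \<and> b \<xi> \<le> S \<xi>" for i b
  proof (rule weighted_int[OF i])
    show "(\<lambda>\<xi>. (b \<xi>)\<^sup>2) \<in> borel_measurable M" using b(1) by measurable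
    show "integrable M (\<lambda>\<xi>. (S \<xi>)\<^sup>2)" using B(3) by (simp add: S_def)
    show "AE \<xi> in M. norm ((b \<xi>)\<^sup>2) \<le> (S \<xi>)\<^sup>2"
      using b(2) by eventually_elim (simp add: power_mono)
  qed
  have normV_int: "integrable M (\<lambda>\<xi>. w \<xi> i *\<^sub>R (norm (V \<xi> i))\<^sup>2)" if i: "i \<in> I" for i
  proof (rule sq_int[OF i])
    show "(\<lambda>\<xi>. norm (V \<xi> i)) \<in> borel_measurable M" using V[OF i] by measurable
    show "AE \<xi> in M. 0 \<le> norm (V \<xi> i) \<and> norm (V \<xi> i) \<le> S \<xi>"
      using bounds by eventually_elim (use i in force)
  qed
  have B_int: "integrable M (\<lambda>\<xi>. w \<xi> i *\<^sub>R (B i \<xi>)\<^sup>2)" if i: "i \<in> I" for i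
    using bounds i by (intro sq_int[OF i B(1)[OF i]]) (auto elim!: eventually_mono)
  show "integrable M (\<lambda>\<xi>. \<Sum>i\<in>I. w \<xi> i *\<^sub>R V \<xi> i)"
    using V_int by simp
  show Q: "prob_space Q"
    unfolding Q_def by (rule prob_space_mixture[OF I w])
  have V_Q': "integrable Q (\<lambda>(\<xi>, i). V \<xi> i)"
    "(\<integral>(\<xi>, i). V \<xi> i \<partial>Q) = (\<Sum>i\<in>I. \<integral>\<xi>. w \<xi> i *\<^sub>R V \<xi> i \<partial>M)"
    unfolding Q_def
    by (rule mixture_integral[where w = w and F = V, OF I w(1) w(2) V V_int]; assumption)+
  show V_Q: "integrable Q (\<lambda>(\<xi>, i). V \<xi> i)" by (rule V_Q'(1))
  show mean: "(\<integral>(\<xi>, i). V \<xi> i \<partial>Q) = m"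
    using V_Q'(2) V_int by (simp add: m_def)
  have sq_meas: "(\<lambda>\<xi>. (norm (V \<xi> i))\<^sup>2) \<in> borel_measurable M" "(\<lambda>\<xi>. (B i \<xi>)\<^sup>2) \<in> borel_measurable M"
    if "i \<in> I" for i using V[OF that] B(1)[OF that] by measurable
  have sqV: "integrable Q (\<lambda>(\<xi>, i). (norm (V \<xi> i))\<^sup>2)"
    "(\<integral>(\<xi>, i). (norm (V \<xi> i))\<^sup>2 \<partial>Q) = (\<Sum>i\<in>I. \<integral>\<xi>. w \<xi> i *\<^sub>R (norm (V \<xi> i))\<^sup>2 \<partial>M)"
    unfolding Q_def
    by (rule mixture_integral[where w = w and F = "\<lambda>\<xi> i. (norm (V \<xi> i))\<^sup>2",
          OF I w(1) w(2) sq_meas(1) normV_int]; assumption)+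
  have sqB: "(\<integral>(\<xi>, i). (B i \<xi>)\<^sup>2 \<partial>Q) = (\<Sum>i\<in>I. \<integral>\<xi>. w \<xi> i *\<^sub>R (B i \<xi>)\<^sup>2 \<partial>M)"
    unfolding Q_def
    by (rule mixture_integral(2)[where w = w and F = "\<lambda>\<xi> i. (B i \<xi>)\<^sup>2",
          OF I w(1) w(2) sq_meas(2) B_int]; assumption)
  have var: "integrable Q (\<lambda>z. (norm (case_prod V z - m))\<^sup>2)"
    "(\<integral>z. (norm (case_prod V z - m))\<^sup>2 \<partial>Q) \<le> (\<integral>(\<xi>, i). (norm (V \<xi> i))\<^sup>2 \<partial>Q)"
    using prob_space.variance_le_second_moment[OF Q V_Q] sqV(1) mean by (auto simp: case_prod_beta')
  show "integrable Q (\<lambda>(\<xi>, i). (norm (V \<xi> i - m))\<^sup>2)"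
    using var(1) by (simp add: case_prod_beta')
  have "(\<integral>(\<xi>, i). (norm (V \<xi> i))\<^sup>2 \<partial>Q) \<le> (\<integral>(\<xi>, i). (B i \<xi>)\<^sup>2 \<partial>Q)"
    unfolding sqV(2) sqB
  proof (intro sum_mono integral_mono_AE normV_int B_int)
    fix i assume i: "i \<in> I"
    show "AE \<xi> in M. w \<xi> i *\<^sub>R (norm (V \<xi> i))\<^sup>2 \<le> w \<xi> i *\<^sub>R (B i \<xi>)\<^sup>2"
      using B(2)[OF i] by eventually_elim (use w(2)[OF i] in \<open>simp add: mult_left_mono power_mono\<close>)
  qed
  with var(2) show "(\<integral>(\<xi>, i). (norm (V \<xi> i - m))\<^sup>2 \<partial>Q) \<le> (\<integral>(\<xi>, i). (B i \<xi>)\<^sup>2 \<partial>Q)"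
    by (simp add: case_prod_beta')
  have "(\<integral>(\<xi>, i). (B i \<xi>)\<^sup>2 \<partial>Q) = expectation (\<lambda>\<xi>. \<Sum>i\<in>I. w \<xi> i * (B i \<xi>)\<^sup>2)"
    using sqB B_int by simp
  also have "\<dots> \<le> expectation (\<lambda>\<xi>. (S \<xi>)\<^sup>2)"
  proof (rule integral_mono_AE)
    show "AE \<xi> in M. (\<Sum>i\<in>I. w \<xi> i * (B i \<xi>)\<^sup>2) \<le> (S \<xi>)\<^sup>2"
      using bounds by eventually_elim (intro weighted_mean_le w power_mono, auto)
  qed (use B(3) B_int in \<open>auto simp: S_def\<close>)
  finally show "(\<integral>(\<xi>, i). (B i \<xi>)\<^sup>2 \<partial>Q) \<le> expectation (\<lambda>\<xi>. (\<Sum>i\<in>I. B i \<xi>)\<^sup>2)"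
    by (simp add: S_def)
qed

section \<open>The smoothed expected maximum and its stochastic gradient\<close>

lemma log_sum_exp_eq:
  "log_sum_exp q ht x \<mu> \<xi> = \<mu> * lse {1..q} (\<lambda>i. ht i x \<mu> \<xi> / \<mu>)"
  by (simp add: log_sum_exp_def lse_def)

lemma index_prob_eq:
  "index_prob q ht x \<mu> \<xi> i = softmax {1..q} (\<lambda>i. ht i x \<mu> \<xi> / \<mu>) i"
  by (simp add: index_prob_def softmax_def)

theorem lemma6:
  fixes X :: "'a::euclidean_space set"
    and \<Omega> :: "'w measure"
    and xi :: "'w \<Rightarrow> 'm::euclidean_space"
    and P :: "'m measure"
    and q :: nat
    and mubar :: real
    and f :: "'a \<Rightarrow> real"
    and h :: "nat \<Rightarrow> 'a \<Rightarrow> 'm \<Rightarrow> real"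
    and ht :: "nat \<Rightarrow> 'a \<Rightarrow> real \<Rightarrow> 'm \<Rightarrow> real"
    and \<kappa> K L M :: "nat \<Rightarrow> 'm \<Rightarrow> real"
  assumes X: "closed X" "convex X"
    and q: "q \<ge> 1"
    and mubar: "mubar > 0"
    and xi: "prob_space \<Omega>" "xi \<in> borel_measurable \<Omega>" "P = distr \<Omega> borel xi"
    and f: "convex_on X f" "f differentiable_on X" "\<exists>C. C-lipschitz_on X (grad X f)"
    and h_convex: "\<And>i \<xi>. i \<in> {1..q} \<Longrightarrow> \<xi> \<in> law_support P \<Longrightarrow> convex_on X (\<lambda>x. h i x \<xi>)"
    and h_finite: "\<And>x. x \<in> X \<Longrightarrow> integrable P (\<lambda>\<xi>. Max ((\<lambda>i. h i x \<xi>) ` {1..q}))"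
    and h_cont: "continuous_on X (expected_max P q h)"
    and ht_meas: "\<And>i x \<mu>. i \<in> {1..q} \<Longrightarrow> x \<in> X \<Longrightarrow> \<mu> \<in> {0<..mubar} \<Longrightarrow>
           (\<lambda>\<xi>. ht i x \<mu> \<xi>) \<in> borel_measurable P"
    and grad_meas: "\<And>i x \<mu>. i \<in> {1..q} \<Longrightarrow> x \<in> X \<Longrightarrow> \<mu> \<in> {0<..mubar} \<Longrightarrow>
           (\<lambda>\<xi>. grad X (\<lambda>y. ht i y \<mu> \<xi>) x) \<in> borel_measurable P"
    and ht_smoothing: "\<And>i. i \<in> {1..q} \<Longrightarrow> AE \<xi> in P. \<xi> \<in> law_support P \<longrightarrow>
           smoothing_function X mubar (\<lambda>x. h i x \<xi>) (\<lambda>x \<mu>. ht i x \<mu> \<xi>) (\<kappa> i \<xi>) (K i \<xi>) (L i \<xi>)"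
    and ht_bound: "\<And>i. i \<in> {1..q} \<Longrightarrow> AE \<xi> in P. \<xi> \<in> law_support P \<longrightarrow>
           0 \<le> M i \<xi> \<and> (\<forall>x\<in>X. \<forall>\<mu>\<in>{0<..mubar}. norm (grad X (\<lambda>y. ht i y \<mu> \<xi>) x) \<le> M i \<xi>)"
    and M_meas: "\<And>i. i \<in> {1..q} \<Longrightarrow> M i \<in> borel_measurable P"
    and kappa_int: "integrable P (\<lambda>\<xi>. sqrt (\<Sum>i=1..q. (\<kappa> i \<xi>)\<^sup>2))"
    and K_int: "\<And>i. i \<in> {1..q} \<Longrightarrow> integrable P (K i)"
    and L_int: "integrable P (\<lambda>\<xi>. (\<Sum>i=1..q. M i \<xi>)\<^sup>2 + (\<Sum>i=1..q. L i \<xi>))"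
  shows "(\<forall>x\<in>X. \<forall>\<mu>\<in>{0<..mubar}. integrable P (log_sum_exp q ht x \<mu>)) \<and>
         smoothing_function X mubar (expected_max P q h) (expected_lse P q ht)
           (ln (real q) + (\<integral>\<xi>. sqrt (\<Sum>i=1..q. (\<kappa> i \<xi>)\<^sup>2) \<partial>P))
           (\<Sum>i=1..q. (\<integral>\<xi>. K i \<xi> \<partial>P))
           (\<integral>\<xi>. (\<Sum>i=1..q. M i \<xi>)\<^sup>2 + (\<Sum>i=1..q. L i \<xi>) \<partial>P) \<and>
         unbiased_bounded_variance X mubar
           (\<lambda>x \<mu>. f x + expected_lse P q ht x \<mu>)
           (stoch_grad X f ht)
           (sample_law P q ht)
           (\<lambda>x \<mu>. (\<integral>(\<xi>, i). (M i \<xi>)\<^sup>2 \<partial>sample_law P q ht x \<mu>))"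
proof -
  let ?I = "{1..q}"
  have I: "finite ?I" "?I \<noteq> {}" using q by auto
  interpret \<Omega>: prob_space \<Omega> by (rule xi(1))
  interpret P: prob_space P
    unfolding xi(3) using xi(2) by (rule \<Omega>.prob_space_distr)
  have supp: "AE \<xi> in P. \<xi> \<in> law_support P"
    by (rule AE_in_law_support) (simp add: xi(3))
  define c where "c x \<xi> = Max ((\<lambda>i. h i x \<xi>) ` ?I)" for x \<xi>
  define k where "k \<xi> = ln (real q) + sqrt (\<Sum>i\<in>?I. (\<kappa> i \<xi>)\<^sup>2)" for \<xi>
  define S where "S \<xi> = (\<Sum>i\<in>?I. M i \<xi>)" for \<xi>
  define V where "V x \<mu> \<xi> i = grad X (\<lambda>y. ht i y \<mu> \<xi>) x" for x \<mu> \<xi> i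
  define g where "g x \<mu> \<xi> = (\<Sum>i\<in>?I. index_prob q ht x \<mu> \<xi> i *\<^sub>R V x \<mu> \<xi> i)" for x \<mu> \<xi>

  \<comment> \<open>The hypotheses concern the points of the support, which has full measure.\<close>
  have hyps: "AE \<xi> in P. \<forall>i\<in>?I.
      smoothing_function X mubar (\<lambda>x. h i x \<xi>) (\<lambda>x \<mu>. ht i x \<mu> \<xi>) (\<kappa> i \<xi>) (K i \<xi>) (L i \<xi>) \<and>
      0 \<le> M i \<xi> \<and> (\<forall>x\<in>X. \<forall>\<mu>\<in>{0<..mubar}. norm (V x \<mu> \<xi> i) \<le> M i \<xi>)"
  proof (rule AE_finite_allI[OF I(1)])
    fix i assume i: "i \<in> ?I"
    show "AE \<xi> in P.
      smoothing_function X mubar (\<lambda>x. h i x \<xi>) (\<lambda>x \<mu>. ht i x \<mu> \<xi>) (\<kappa> i \<xi>) (K i \<xi>) (L i \<xi>) \<and>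
      0 \<le> M i \<xi> \<and> (\<forall>x\<in>X. \<forall>\<mu>\<in>{0<..mubar}. norm (V x \<mu> \<xi> i) \<le> M i \<xi>)"
      using supp ht_smoothing[OF i] ht_bound[OF i] by eventually_elim (simp add: V_def)
  qed
  have pointwise: "AE \<xi> in P.
      smoothing_function X mubar (\<lambda>x. c x \<xi>) (\<lambda>x \<mu>. log_sum_exp q ht x \<mu> \<xi>)
        (k \<xi>) (\<Sum>i\<in>?I. K i \<xi>) ((S \<xi>)\<^sup>2 + (\<Sum>i\<in>?I. L i \<xi>)) \<and>
      (\<forall>x\<in>X. \<forall>\<mu>\<in>{0<..mubar}. grad X (\<lambda>y. log_sum_exp q ht y \<mu> \<xi>) x = g x \<mu> \<xi>)"
    using hyps
  proof eventually_elim
    case (elim \<xi>)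
    note lse = smoothing_function_scaled_lse[OF I X(2), where mubar = mubar and c = "\<lambda>i x. h i x \<xi>"
        and ct = "\<lambda>i x \<mu>. ht i x \<mu> \<xi>" and \<kappa> = "\<lambda>i. \<kappa> i \<xi>" and K = "\<lambda>i. K i \<xi>" and L = "\<lambda>i. L i \<xi>"
        and M = "\<lambda>i. M i \<xi>"]
    show ?case
      using lse elim
      unfolding log_sum_exp_eq index_prob_eq c_def k_def S_def g_def V_def by simp
  qed

  \<comment> \<open>Only the sum with the \<open>L i\<close> is known to be integrable; positivity of the \<open>L i\<close> makes it a dominating function.\<close>
  have sq_int: "integrable P (\<lambda>\<xi>. (S \<xi>)\<^sup>2)"
  proof (rule Bochner_Integration.integrable_bound[OF L_int])
    show "(\<lambda>\<xi>. (S \<xi>)\<^sup>2) \<in> borel_measurable P"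
      unfolding S_def using M_meas by measurable
    show "AE \<xi> in P. norm ((S \<xi>)\<^sup>2) \<le> norm ((\<Sum>i=1..q. M i \<xi>)\<^sup>2 + (\<Sum>i=1..q. L i \<xi>))"
      using hyps
    proof eventually_elim
      case (elim \<xi>)
      then have "(\<Sum>i=1..q. L i \<xi>) \<ge> 0"
        by (intro sum_nonneg) (auto dest!: bspec smoothing_functionD(2))
      then show ?case by (simp add: S_def)
    qed
  qed

  have prob_meas: "(\<lambda>\<xi>. index_prob q ht x \<mu> \<xi> i) \<in> borel_measurable P"
    if "i \<in> ?I" "x \<in> X" "\<mu> \<in> {0<..mubar}" for i x \<mu>
    unfolding index_prob_def using ht_meas[OF _ that(2,3)] that(1) by measurable
  have prob_sum: "(\<Sum>i\<in>?I. index_prob q ht x \<mu> \<xi> i) = 1" for x \<mu> \<xi>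
    unfolding index_prob_eq by (rule sum_softmax[OF I])
  have prob_nonneg: "0 \<le> index_prob q ht x \<mu> \<xi> i" for x \<mu> \<xi> i
    unfolding index_prob_eq by (rule softmax_nonneg)
  have bound: "AE \<xi> in P. norm (V x \<mu> \<xi> i) \<le> M i \<xi>"
    if "i \<in> ?I" "x \<in> X" "\<mu> \<in> {0<..mubar}" for i x \<mu>
    using hyps by eventually_elim (use that in blast)
  have sample: "integrable P (g x \<mu>)"
      "prob_space (sample_law P q ht x \<mu>)"
      "integrable (sample_law P q ht x \<mu>) (\<lambda>(\<xi>, i). V x \<mu> \<xi> i)"
      "(\<integral>(\<xi>, i). V x \<mu> \<xi> i \<partial>sample_law P q ht x \<mu>) = P.expectation (g x \<mu>)"
      "integrable (sample_law P q ht x \<mu>) (\<lambda>(\<xi>, i). (norm (V x \<mu> \<xi> i - P.expectation (g x \<mu>)))\<^sup>2)"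
      "(\<integral>(\<xi>, i). (norm (V x \<mu> \<xi> i - P.expectation (g x \<mu>)))\<^sup>2 \<partial>sample_law P q ht x \<mu>)
        \<le> (\<integral>(\<xi>, i). (M i \<xi>)\<^sup>2 \<partial>sample_law P q ht x \<mu>)"
      "(\<integral>(\<xi>, i). (M i \<xi>)\<^sup>2 \<partial>sample_law P q ht x \<mu>) \<le> P.expectation (\<lambda>\<xi>. (S \<xi>)\<^sup>2)"
    if x: "x \<in> X" and \<mu>: "\<mu> \<in> {0<..mubar}" for x \<mu>
    unfolding sample_law_def g_def S_def
    by (rule P.mixture_mean_variance[where V = "V x \<mu>" and B = M and w = "index_prob q ht x \<mu>"];
        use prob_meas[OF _ x \<mu>] prob_nonneg prob_sum grad_meas[OF _ x \<mu>] bound[OF _ x \<mu>] M_meas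
          sq_int I in \<open>simp add: V_def S_def\<close>)+

  note E = P.smoothing_function_expectation[OF X(2), where mubar = mubar and c = c
      and F = "log_sum_exp q ht" and g = g and \<kappa> = k and K = "\<lambda>\<xi>. \<Sum>i\<in>?I. K i \<xi>"
      and L = "\<lambda>\<xi>. (S \<xi>)\<^sup>2 + (\<Sum>i\<in>?I. L i \<xi>)"]
  have E_prems: "AE \<xi> in P. smoothing_function X mubar (\<lambda>x. c x \<xi>) (\<lambda>x \<mu>. log_sum_exp q ht x \<mu> \<xi>)
        (k \<xi>) (\<Sum>i\<in>?I. K i \<xi>) ((S \<xi>)\<^sup>2 + (\<Sum>i\<in>?I. L i \<xi>))"
      "integrable P k" "integrable P (\<lambda>\<xi>. \<Sum>i\<in>?I. K i \<xi>)"
      "integrable P (\<lambda>\<xi>. (S \<xi>)\<^sup>2 + (\<Sum>i\<in>?I. L i \<xi>))"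
      "\<And>x. x \<in> X \<Longrightarrow> integrable P (c x)"
      "continuous_on X (\<lambda>x. P.expectation (c x))"
      "\<And>x \<mu>. x \<in> X \<Longrightarrow> \<mu> \<in> {0<..mubar} \<Longrightarrow> log_sum_exp q ht x \<mu> \<in> borel_measurable P"
      "\<And>x \<mu>. x \<in> X \<Longrightarrow> \<mu> \<in> {0<..mubar} \<Longrightarrow> integrable P (g x \<mu>)"
      "\<And>x \<mu>. x \<in> X \<Longrightarrow> \<mu> \<in> {0<..mubar} \<Longrightarrow>
         AE \<xi> in P. grad X (\<lambda>y. log_sum_exp q ht y \<mu> \<xi>) x = g x \<mu> \<xi>"
  proof -
    show "integrable P k" unfolding k_def using kappa_int by simp
    show "integrable P (\<lambda>\<xi>. \<Sum>i\<in>?I. K i \<xi>)" using K_int by (intro Bochner_Integration.integrable_sum)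
    show "log_sum_exp q ht x \<mu> \<in> borel_measurable P" if "x \<in> X" "\<mu> \<in> {0<..mubar}" for x \<mu>
      unfolding log_sum_exp_def[abs_def] using ht_meas[OF _ that] by measurable
    show "AE \<xi> in P. grad X (\<lambda>y. log_sum_exp q ht y \<mu> \<xi>) x = g x \<mu> \<xi>"
      if "x \<in> X" "\<mu> \<in> {0<..mubar}" for x \<mu>
      using pointwise by eventually_elim (use that in blast)
    show "continuous_on X (\<lambda>x. P.expectation (c x))"
      using h_cont by (simp add: expected_max_def[abs_def] c_def[abs_def])
    show "integrable P (c x)" if "x \<in> X" for x
      using h_finite[OF that] by (simp add: c_def[abs_def])
  qed (use pointwise L_int sample(1) in \<open>auto simp: S_def elim: eventually_mono\<close>)
  have F_int: "integrable P (log_sum_exp q ht x \<mu>)" if "x \<in> X" "\<mu> \<in> {0<..mubar}" for x \<mu>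
    by (rule E(1)[OF E_prems that])
  have smooth: "smoothing_function X mubar (expected_max P q h) (expected_lse P q ht)
           (ln (real q) + (\<integral>\<xi>. sqrt (\<Sum>i=1..q. (\<kappa> i \<xi>)\<^sup>2) \<partial>P))
           (\<Sum>i=1..q. (\<integral>\<xi>. K i \<xi> \<partial>P))
           (\<integral>\<xi>. (\<Sum>i=1..q. M i \<xi>)\<^sup>2 + (\<Sum>i=1..q. L i \<xi>) \<partial>P)"
  proof -
    have "P.expectation k = ln (real q) + (\<integral>\<xi>. sqrt (\<Sum>i=1..q. (\<kappa> i \<xi>)\<^sup>2) \<partial>P)"
      unfolding k_def using kappa_int by (simp add: P.prob_space)
    moreover have "P.expectation (\<lambda>\<xi>. \<Sum>i\<in>?I. K i \<xi>) = (\<Sum>i=1..q. (\<integral>\<xi>. K i \<xi> \<partial>P))"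
      using K_int by (intro Bochner_Integration.integral_sum) auto
    ultimately show ?thesis
      using E(2)[OF E_prems]
      by (simp add: expected_max_def[abs_def] expected_lse_def[abs_def] c_def[abs_def] S_def)
  qed
  have grad_lse: "grad X (\<lambda>y. expected_lse P q ht y \<mu>) x = P.expectation (g x \<mu>)"
    if "x \<in> X" "\<mu> \<in> {0<..mubar}" for x \<mu>
    using E(3)[OF E_prems that] by (simp add: expected_lse_def)

  have "unbiased_bounded_variance X mubar (\<lambda>x \<mu>. f x + expected_lse P q ht x \<mu>)
      (stoch_grad X f ht) (sample_law P q ht) (\<lambda>x \<mu>. (\<integral>(\<xi>, i). (M i \<xi>)\<^sup>2 \<partial>sample_law P q ht x \<mu>))"
    unfolding unbiased_bounded_variance_def
  proof (intro conjI ballI exI)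
    fix x \<mu> assume x: "x \<in> X" and \<mu>: "\<mu> \<in> {0<..mubar}"
    let ?Q = "sample_law P q ht x \<mu>"
    interpret Q: prob_space ?Q by (rule sample(2)[OF x \<mu>])
    have "is_grad X f x (grad X f x)"
      using f(2) x X(2) by (auto simp: differentiable_on_def intro: is_grad_grad)
    from grad_eq[OF X(2) x is_grad_add[OF this smoothing_function_is_grad[OF smooth X(2) x \<mu>]]]
    have grad: "grad X (\<lambda>y. f y + expected_lse P q ht y \<mu>) x = grad X f x + P.expectation (g x \<mu>)"
      using grad_lse[OF x \<mu>] by simp
    have G: "stoch_grad X f ht x \<mu> = (\<lambda>z. grad X f x + (case z of (\<xi>, i) \<Rightarrow> V x \<mu> \<xi> i))"
      by (auto simp: stoch_grad_def V_def)
    \<comment> \<open>The gradient of \<open>f\<close> is deterministic and cancels in the deviation from the mean.\<close>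
    have dev: "(\<lambda>z. (norm (stoch_grad X f ht x \<mu> z - grad X (\<lambda>y. f y + expected_lse P q ht y \<mu>) x))\<^sup>2)
        = (\<lambda>(\<xi>, i). (norm (V x \<mu> \<xi> i - P.expectation (g x \<mu>)))\<^sup>2)"
      unfolding grad G by (auto simp: algebra_simps)
    show "(\<integral>(\<xi>, i). (M i \<xi>)\<^sup>2 \<partial>?Q) \<le> P.expectation (\<lambda>\<xi>. (S \<xi>)\<^sup>2)"
      by (rule sample(7)[OF x \<mu>])
    show "integrable ?Q (stoch_grad X f ht x \<mu>)"
      unfolding G using sample(3)[OF x \<mu>] by (intro Bochner_Integration.integrable_add) auto
    show "(\<integral>z. stoch_grad X f ht x \<mu> z \<partial>?Q) = grad X (\<lambda>y. f y + expected_lse P q ht y \<mu>) x"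
      unfolding G grad using sample(3,4)[OF x \<mu>] by (simp add: Q.prob_space)
    show "integrable ?Q (\<lambda>z. (norm (stoch_grad X f ht x \<mu> z - grad X (\<lambda>y. f y + expected_lse P q ht y \<mu>) x))\<^sup>2)"
      unfolding dev by (rule sample(5)[OF x \<mu>])
    show "(\<integral>z. (norm (stoch_grad X f ht x \<mu> z - grad X (\<lambda>y. f y + expected_lse P q ht y \<mu>) x))\<^sup>2 \<partial>?Q)
        \<le> (\<integral>(\<xi>, i). (M i \<xi>)\<^sup>2 \<partial>?Q)"
      unfolding dev by (rule sample(6)[OF x \<mu>])
  qed
  with F_int smooth show ?thesis by blast
qed

end
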